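(* We have $$C_{1324,4231}(x)=\left(\prod_{i\ge 1}(1+x^i)+\sum_{a,b\ge 0}x^{(a+2)(b+1)}\cdot\prod_{i=1}^a(1+x^i)\cdot\prod_{i=1}^b(1+x^i)\right)^2.$$
   Context: $\mathrm{av}_n^k(B)$ is the number of permutations in $S_n$ with exactly $k$ inversions (pairs $i<j$ with $\pi_i>\pi_j$) that avoid every pattern in $B$; a permutation avoids a pattern $q$ if it has no subsequence order-isomorphic to $q$. If for every $k\ge0$ there are constants $m_k,c_k(B)$ with $\mathrm{av}_n^k(B)=c_k(B)$ for all $n\ge m_k$, then $(c_k(B))_{k\ge0}$ is the limit sequence of $B$ and $C_B(x)=\sum_{k\ge 0}c_k(B)x^k$ is its limit generating function (a formal power series); here $B=\{1324,4231\}$. *)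

theory Defs
  imports
    "HOL-Analysis.Analysis"
    "HOL-Library.Sublist"
    "HOL-Combinatorics.Multiset_Permutations"
    "HOL-Computational_Algebra.Formal_Power_Series"
begin

text \<open>
  Permutations in \<open>S\<^sub>n\<close> are written in one-line notation, as the elements of
  \<open>permutations_of_set {1..n}\<close>; patterns are lists in the same notation.
\<close>

definition inversions :: "nat list \<Rightarrow> nat" where
  "inversions p = card {(i, j). i < j \<and> j < length p \<and> p ! i > p ! j}"

definition order_isomorphic :: "nat list \<Rightarrow> nat list \<Rightarrow> bool" where
  "order_isomorphic xs ys \<longleftrightarrow> length xs = length ys \<and>
     (\<forall>i<length xs. \<forall>j<length xs. xs ! i < xs ! j \<longleftrightarrow> ys ! i < ys ! j)"

text \<open>The library predicate \<^const>\<open>subseq\<close> does not require the entries to be adjacent.\<close>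

definition avoids :: "nat list \<Rightarrow> nat list \<Rightarrow> bool" where
  "avoids p q \<longleftrightarrow> \<not> (\<exists>s. subseq s p \<and> order_isomorphic s q)"

definition av :: "nat list set \<Rightarrow> nat \<Rightarrow> nat \<Rightarrow> nat" where
  "av B n k = card {p \<in> permutations_of_set {1..n}. inversions p = k \<and> (\<forall>q\<in>B. avoids p q)}"

definition is_limit_sequence :: "nat list set \<Rightarrow> (nat \<Rightarrow> nat) \<Rightarrow> bool" where
  "is_limit_sequence B c \<longleftrightarrow> (\<forall>k. \<exists>m. \<forall>n\<ge>m. av B n k = c k)"

text \<open>
  The next two constants are meaningful only when a limit sequence of \<open>B\<close> exists;
  it is then unique by the following lemma.
\<close>

definition limit_sequence :: "nat list set \<Rightarrow> nat \<Rightarrow> nat" where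
  "limit_sequence B = (THE c. is_limit_sequence B c)"

definition limit_gf :: "nat list set \<Rightarrow> int fps" where
  "limit_gf B = Abs_fps (\<lambda>k. int (limit_sequence B k))"

lemma is_limit_sequence_unique:
  assumes "is_limit_sequence B c" "is_limit_sequence B d"
  shows "c = d"
proof
  fix k
  obtain m1 m2 where "\<forall>n\<ge>m1. av B n k = c k" "\<forall>n\<ge>m2. av B n k = d k"
    using assms unfolding is_limit_sequence_def by blast
  then have "av B (max m1 m2) k = c k" "av B (max m1 m2) k = d k"
    by (meson max.cobounded1 max.cobounded2)+
  then show "c k = d k" by simp
qed

lemma limit_sequence_eqI: "is_limit_sequence B c \<Longrightarrow> limit_sequence B = c"
  unfolding limit_sequence_def by (blast intro: the_equality is_limit_sequence_unique)

text \<open>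
  Infinite products and sums of formal power series refer to the \<open>X\<close>-adic topology, that is,
  to eventual stabilisation of every coefficient. The two lemmas below show that the
  ones needed here converge, so that \<^const>\<open>prodinf\<close> and \<^const>\<open>infsum\<close> do not
  take default values.
\<close>

lemma convergent_prod_one_plus_X_power:
  "convergent_prod (\<lambda>i. 1 + fps_X ^ (i + 1) :: int fps)"
proof -
  define P :: "nat \<Rightarrow> int fps" where "P n = (\<Prod>i\<le>n. 1 + fps_X ^ (i + 1))" for n
  define L where "L = Abs_fps (\<lambda>n. fps_nth (P n) n)"
  have PS: "P (Suc n) = P n + fps_X ^ (n + 2) * P n" for n
    by (simp add: P_def algebra_simps)
  have stable: "fps_nth (P N) n = fps_nth (P n) n" if "n \<le> N" for n N
    using that
  proof (induction N rule: dec_induct)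
    case (step N)
    then show ?case by (simp add: PS fps_X_power_mult_nth del: power_Suc)
  qed simp
  have "P \<longlonglongrightarrow> L"
    unfolding tendsto_fps_iff eventually_sequentially L_def fps_nth_Abs_fps
    using stable by blast
  moreover have "fps_nth L 0 = 1"
    by (simp add: L_def P_def)
  then have "L \<noteq> 0" by auto
  ultimately have "raw_has_prod (\<lambda>i. 1 + fps_X ^ (i + 1) :: int fps) 0 L"
    by (simp add: raw_has_prod_def P_def[abs_def])
  then show ?thesis unfolding convergent_prod_def by blast
qed

lemma summable_on_X_power_times:
  fixes f g :: "nat \<Rightarrow> int fps"
  shows "(\<lambda>(a, b). fps_X ^ ((a + 2) * (b + 1)) * f a * g b) summable_on UNIV"
proof -
  define t where "t = (\<lambda>(a, b). fps_X ^ ((a + 2) * (b + 1)) * f a * g b)"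
  define L where "L = Abs_fps (\<lambda>n. fps_nth (sum t ({..n} \<times> {..n})) n)"
  have zero: "fps_nth (t x) n = 0" if "x \<notin> {..n} \<times> {..n}" for x n
  proof -
    obtain a b where x: "x = (a, b)" by fastforce
    with that consider "n < a" | "n < b" by fastforce
    then have "n < (a + 2) * (b + 1)" by cases auto
    then show ?thesis by (simp add: t_def x mult.assoc fps_X_power_mult_nth del: mult_Suc mult_Suc_right)
  qed
  have "(sum t \<longlongrightarrow> L) (finite_subsets_at_top UNIV)"
    unfolding tendsto_fps_iff
  proof
    fix n
    show "\<forall>\<^sub>F A in finite_subsets_at_top UNIV. fps_nth (sum t A) n = fps_nth L n"
      unfolding eventually_finite_subsets_at_top
    proof (intro exI[of _ "{..n} \<times> {..n}"] conjI allI impI)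
      fix A assume A: "finite A \<and> {..n} \<times> {..n} \<subseteq> A \<and> A \<subseteq> UNIV"
      have "(\<Sum>x\<in>{..n} \<times> {..n}. fps_nth (t x) n) = (\<Sum>x\<in>A. fps_nth (t x) n)"
        using A zero by (intro sum.mono_neutral_left) auto
      then show "fps_nth (sum t A) n = fps_nth L n"
        by (simp add: L_def fps_sum_nth)
    qed auto
  qed
  then show ?thesis
    unfolding summable_on_def has_sum_def t_def by blast
qed

end

theory Submission
  imports Defs
begin

text \<open>
  Let \<open>\<pi>\<close> avoid 1324 and have \<open>k\<close> inversions. If its length is large, then on either side of a
  central position there is an entry that takes part in no inversion, and if the central
  entry took part in one, this would produce a 1324. So \<open>\<pi> = \<alpha> \<oplus> 1 \<oplus> \<beta>\<close>, where \<open>\<alpha>\<close> avoids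
  132 and 4231 and \<open>\<beta>\<close> avoids 213 and 4231; conversely all such sums are admissible. The reverse
  complement exchanges the two conditions, which explains the square.

  A permutation avoids 132 iff its Lehmer code is weakly decreasing, so that the code without its
  zeros is a partition of the number of inversions. It also avoids 4231 iff, in addition,
  consecutive parts before the last repeated part differ by at most 1. Such a partition either has
  distinct parts (the infinite product) or a last repeated part \<open>b + 1\<close>, at positions \<open>a + 1\<close>
  and \<open>a + 2\<close> say. In the second case it consists of an \<open>(a + 2) \<times> (b + 1)\<close> rectangle, distinct
  parts of size at most \<open>b\<close> below it, and the conjugate of a partition into distinct parts of size
  at most \<open>a\<close> to the right of it.
\<close>

section \<open>Pattern avoidance and Lehmer codes\<close>

text \<open>The library rule \<open>subseq_Cons2_iff\<close> matches equal heads greedily. The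
  disjunction keeps both kinds of occurrence visible: those that use the first entry and those
  inside the rest.\<close>

lemma subseq_Cons_Cons:
  "subseq (a # as) (x # xs) \<longleftrightarrow> a = x \<and> subseq as xs \<or> subseq (a # as) xs"
  by (metis subseq_Cons2_iff subseq_Cons')

lemma order_isomorphic_132: "order_isomorphic s [1, 3, 2] \<longleftrightarrow> (\<exists>a b c. s = [a, b, c] \<and> a < c \<and> c < b)"
  by (auto simp: order_isomorphic_def All_less_Suc length_Suc_conv numeral_eq_Suc less_Suc_eq)

lemma order_isomorphic_213: "order_isomorphic s [2, 1, 3] \<longleftrightarrow> (\<exists>a b c. s = [a, b, c] \<and> b < a \<and> a < c)"
  by (auto simp: order_isomorphic_def All_less_Suc length_Suc_conv numeral_eq_Suc less_Suc_eq)

lemma order_isomorphic_231: "order_isomorphic s [2, 3, 1] \<longleftrightarrow> (\<exists>a b c. s = [a, b, c] \<and> c < a \<and> a < b)"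
  by (auto simp: order_isomorphic_def All_less_Suc length_Suc_conv numeral_eq_Suc less_Suc_eq)

lemma order_isomorphic_1324:
  "order_isomorphic s [1, 3, 2, 4] \<longleftrightarrow> (\<exists>a b c d. s = [a, b, c, d] \<and> a < c \<and> c < b \<and> b < d)"
  by (auto simp: order_isomorphic_def All_less_Suc length_Suc_conv numeral_eq_Suc less_Suc_eq)

lemma order_isomorphic_4231:
  "order_isomorphic s [4, 2, 3, 1] \<longleftrightarrow> (\<exists>a b c d. s = [a, b, c, d] \<and> d < b \<and> b < c \<and> c < a)"
  by (auto simp: order_isomorphic_def All_less_Suc length_Suc_conv numeral_eq_Suc less_Suc_eq)

lemma avoids_132: "avoids p [1, 3, 2] \<longleftrightarrow> (\<forall>a b c. subseq [a, b, c] p \<longrightarrow> a < c \<longrightarrow> \<not> c < b)"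
  and avoids_213: "avoids p [2, 1, 3] \<longleftrightarrow> (\<forall>a b c. subseq [a, b, c] p \<longrightarrow> b < a \<longrightarrow> \<not> a < c)"
  and avoids_231: "avoids p [2, 3, 1] \<longleftrightarrow> (\<forall>a b c. subseq [a, b, c] p \<longrightarrow> c < a \<longrightarrow> \<not> a < b)"
  and avoids_1324: "avoids p [1, 3, 2, 4] \<longleftrightarrow>
    (\<forall>a b c d. subseq [a, b, c, d] p \<longrightarrow> a < c \<longrightarrow> c < b \<longrightarrow> \<not> b < d)"
  and avoids_4231: "avoids p [4, 2, 3, 1] \<longleftrightarrow>
    (\<forall>a b c d. subseq [a, b, c, d] p \<longrightarrow> d < b \<longrightarrow> b < c \<longrightarrow> \<not> c < a)"
  unfolding avoids_def order_isomorphic_132 order_isomorphic_213 order_isomorphic_231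
    order_isomorphic_1324 order_isomorphic_4231 by blast+

section \<open>Lehmer codes and inversions\<close>

primrec lehmer :: "nat list \<Rightarrow> nat list" where
  "lehmer [] = []"
| "lehmer (x # xs) = card {y \<in> set xs. y < x} # lehmer xs"

lemma length_lehmer [simp]: "length (lehmer xs) = length xs"
  by (induction xs) auto

text \<open>Inversions split by whether their left index is 0. Distinctness makes counting indices
  of smaller entries the same as counting the entries, which is what \<open>lehmer\<close> does
  through \<open>set xs\<close>.\<close>

lemma inversions_Cons:
  assumes "distinct (x # xs)"
  shows "inversions (x # xs) = card {y \<in> set xs. y < x} + inversions xs"
proof -
  let ?n = "length xs"
  let ?A = "(\<lambda>j. (0::nat, Suc j)) ` {j. j < ?n \<and> xs ! j < x}"
  let ?B = "map_prod Suc Suc ` {(i, j). i < j \<and> j < ?n \<and> xs ! i > xs ! j}"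
  have "{(i, j). i < j \<and> j < length (x # xs) \<and> (x # xs) ! i > (x # xs) ! j} = ?A \<union> ?B"
    (is "?I = _")
  proof safe
    fix i j assume "i < j" "j < length (x # xs)" "(x # xs) ! i > (x # xs) ! j" "(i, j) \<notin> ?B"
    then show "(i, j) \<in> ?A"
      by (cases i; cases j) (auto simp: image_iff)
  qed auto
  moreover have "finite {j. j < ?n \<and> xs ! j < x}"
    by (rule finite_subset[of _ "{..<?n}"]) auto
  moreover have "finite {(i, j). i < j \<and> j < ?n \<and> xs ! i > xs ! j}"
    by (rule finite_subset[of _ "{..<?n} \<times> {..<?n}"]) auto
  ultimately have "inversions (x # xs) = card ?A + card ?B"
    unfolding inversions_def by (subst card_Un_disjoint[symmetric]) auto
  also have "card ?B = inversions xs"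
    unfolding inversions_def by (rule card_image) (auto simp: inj_on_def)
  also have "card ?A = card ((!) xs ` {j. j < ?n \<and> xs ! j < x})"
    using assms by (auto simp: card_image inj_on_def nth_eq_iff_index_eq)
  also have "(!) xs ` {j. j < ?n \<and> xs ! j < x} = {y \<in> set xs. y < x}"
    by (auto simp: in_set_conv_nth)
  finally show ?thesis .
qed

lemma inversions_eq_sum_list_lehmer: "distinct xs \<Longrightarrow> inversions xs = sum_list (lehmer xs)"
proof (induction xs)
  case Nil
  show ?case by (simp add: inversions_def)
qed (auto simp: inversions_Cons)

lemma lehmer_map_strict_mono:
  assumes "strict_mono f"
  shows "lehmer (map f xs) = lehmer xs"
proof (induction xs)
  case (Cons x xs)
  have "{y \<in> set (map f xs). y < f x} = f ` {y \<in> set xs. y < x}"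
    using assms by (auto simp: strict_mono_less)
  then show ?case
    using Cons assms by (auto simp: card_image inj_on_def strict_mono_eq)
qed simp

lemma lehmer_append_less:
  assumes "\<And>x y. x \<in> set xs \<Longrightarrow> y \<in> set ys \<Longrightarrow> x < y"
  shows "lehmer (xs @ ys) = lehmer xs @ lehmer ys"
  using assms
proof (induction xs)
  case (Cons x xs)
  have "{y \<in> set (xs @ ys). y < x} = {y \<in> set xs. y < x}"
    using Cons.prems by (auto dest: less_asym)
  then show ?case using Cons by auto
qed simp

text \<open>The first code entry is the rank of the first entry in \<open>A\<close>, and every rank
  below \<open>card A\<close> occurs exactly once. The tail is a permutation of the remaining
  elements, to which the induction applies.\<close>

lemma bij_betw_lehmer:
  assumes "finite A"
  shows "bij_betw lehmer (permutations_of_set A)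
    {c. length c = card A \<and> (\<forall>i<card A. c ! i + i < card A)}"
  using assms
proof (induction "card A" arbitrary: A)
  case 0
  then have "A = {}" by simp
  then show ?case by (auto simp: bij_betw_def)
next
  case (Suc n)
  let ?C = "\<lambda>m. {c::nat list. length c = m \<and> (\<forall>i<m. c ! i + i < m)}"
  let ?r = "\<lambda>x. card {y \<in> A. y < x}"
  have r: "?r x \<noteq> ?r y" if "x \<in> A" "y \<in> A" "x \<noteq> y" for x y
  proof -
    have "?r x < ?r y" if "x \<in> A" "y \<in> A" "x < y" for x y
    proof (rule psubset_card_mono)
      show "finite {z \<in> A. z < y}" using Suc.prems by simp
      show "{z \<in> A. z < x} \<subset> {z \<in> A. z < y}" using that by auto
    qed
    from this[of x y] this[of y x] show ?thesis using that by (cases "x < y") auto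
  qed
  then have inj_r: "inj_on ?r A" by (auto simp: inj_on_def)
  have "?r x < card A" if "x \<in> A" for x
    by (rule psubset_card_mono) (use that Suc.prems in auto)
  then have "?r ` A \<subseteq> {..<card A}" by auto
  then have r_surj: "?r ` A = {..<card A}"
    by (intro card_subset_eq) (simp_all add: card_image[OF inj_r])
  \<comment> \<open>Deleting \<open>x\<close> does not change how many elements lie below it, so the
    first code entry depends on \<open>x\<close> and \<open>A\<close> alone.\<close>
  have rank: "{y \<in> A - {x}. y < x} = {y \<in> A. y < x}" for x by auto
  have IH: "bij_betw lehmer (permutations_of_set (A - {x})) (?C n)" if "x \<in> A" for x
  proof -
    have "n = card (A - {x})" using Suc.hyps(2) that by simp
    then show ?thesis using Suc.hyps(1)[of "A - {x}"] Suc.prems by simp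
  qed
  have perm: "permutations_of_set A = (\<Union>x\<in>A. (#) x ` permutations_of_set (A - {x}))"
    using Suc.hyps(2) by (intro permutations_of_set_nonempty) auto
  have set_perm: "set xs = A - {x}" if "xs \<in> permutations_of_set (A - {x})" for x xs
    using that by (rule permutations_of_setD)
  have "inj_on lehmer (permutations_of_set A)"
  proof (rule inj_onI)
    fix p q assume "p \<in> permutations_of_set A" "q \<in> permutations_of_set A" and eq: "lehmer p = lehmer q"
    then obtain x xs y ys where *: "x \<in> A" "p = x # xs" "xs \<in> permutations_of_set (A - {x})"
        "y \<in> A" "q = y # ys" "ys \<in> permutations_of_set (A - {y})"
      by (auto simp: perm)
    with eq have "?r x = ?r y" by (simp add: set_perm rank del: Diff_iff)
    with * r have "x = y" by blast
    with * eq IH[of x] show "p = q" by (auto dest: bij_betw_imp_inj_on inj_onD)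
  qed
  moreover have "lehmer ` permutations_of_set A = ?C (card A)"
  proof -
    have "lehmer ` permutations_of_set A = (\<Union>x\<in>A. lehmer ` (#) x ` permutations_of_set (A - {x}))"
      by (simp add: perm image_UN)
    also have "\<dots> = (\<Union>x\<in>A. (#) (?r x) ` lehmer ` permutations_of_set (A - {x}))"
      by (intro SUP_cong refl) (auto simp: image_image set_perm rank simp del: Diff_iff intro!: image_cong)
    also have "\<dots> = (\<Union>x\<in>A. (#) (?r x) ` ?C n)"
      by (rule SUP_cong[OF refl]) (simp only: bij_betw_imp_surj_on[OF IH])
    also have "\<dots> = (\<Union>v\<in>?r ` A. (#) v ` ?C n)" by blast
    also have "\<dots> = ?C (Suc n)"
    proof (rule set_eqI)
      fix c
      show "c \<in> (\<Union>v\<in>?r ` A. (#) v ` ?C n) \<longleftrightarrow> c \<in> ?C (Suc n)"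
        unfolding r_surj Suc.hyps(2)[symmetric]
        by (cases c) (auto simp: All_less_Suc2 image_iff)
    qed
    finally show ?thesis using Suc.hyps(2) by simp
  qed
  ultimately show ?case by (simp add: bij_betw_def)
qed

section \<open>Effect of a new first entry on codes and patterns\<close>

declare subseq_Cons2_iff [simp del] subseq_Cons_Cons [simp] subseq_singleton_left [simp]

lemma subseq2_set: "subseq [a, b] xs \<Longrightarrow> a \<in> set xs \<and> b \<in> set xs"
  by (induction xs) auto

lemma avoids_ConsD: "avoids (x # xs) q \<Longrightarrow> avoids xs q"
  unfolding avoids_def by (meson list_emb_Cons)

lemma avoids_132_ConsI:
  assumes "avoids xs [1, 3, 2]" and "\<And>b c. subseq [b, c] xs \<Longrightarrow> x < c \<Longrightarrow> \<not> c < b"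
  shows "avoids (x # xs) [1, 3, 2]"
  using assms unfolding avoids_132 subseq_Cons_Cons by blast

lemma avoids_231_ConsI:
  assumes "avoids xs [2, 3, 1]" and "\<And>b c. subseq [b, c] xs \<Longrightarrow> c < x \<Longrightarrow> \<not> x < b"
  shows "avoids (x # xs) [2, 3, 1]"
  using assms unfolding avoids_231 subseq_Cons_Cons by blast

lemma avoids_4231_ConsI:
  assumes "avoids xs [4, 2, 3, 1]"
    and "\<And>a b c. subseq [a, b, c] xs \<Longrightarrow> c < a \<Longrightarrow> a < b \<Longrightarrow> \<not> b < x"
  shows "avoids (x # xs) [4, 2, 3, 1]"
  using assms unfolding avoids_4231 subseq_Cons_Cons by blast

lemma avoids_132_less_hd:
  assumes "distinct (x # h # ys)" "avoids (x # h # ys) [1, 3, 2]" "x < h" "z \<in> set ys" "z < h"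
  shows "z < x"
proof (rule ccontr)
  assume "\<not> z < x"
  moreover have "z \<noteq> x" using assms(1,4) by auto
  ultimately have "x < z" by simp
  moreover have "subseq [x, h, z] (x # h # ys)" using assms(4) by simp
  ultimately show False using assms(2,5) unfolding avoids_132 by blast
qed

text \<open>On weakly decreasing codes, \<open>has_repeat\<close> detects 231: two adjacent entries of equal
  positive code form an ascent with a smaller entry to their right.\<close>

fun has_repeat :: "nat list \<Rightarrow> bool" where
  "has_repeat (c # d # cs) \<longleftrightarrow> c = d \<and> 0 < c \<or> has_repeat (d # cs)"
| "has_repeat _ \<longleftrightarrow> False"

text \<open>A new first entry can create a 4231 only as its 4, above a 231 in the rest. Hence the
  bound on the drop is tied to a repeat further right, and drops after the last repeat are
  arbitrary.\<close>

fun good_code :: "nat list \<Rightarrow> bool" where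
  "good_code (c # d # cs) \<longleftrightarrow> good_code (d # cs) \<and> d \<le> c \<and> (has_repeat (d # cs) \<longrightarrow> c \<le> Suc d)"
| "good_code _ \<longleftrightarrow> True"

text \<open>If 132 is avoided, no later value lies between the two entries of an ascent, so ascents
  are exactly the equal neighbours in the code. By the next lemma, a descent makes the first code
  entry larger by one plus the number of later values in between.\<close>

lemma lehmer_hd_less:
  fixes x h :: nat
  assumes "distinct (x # h # ys)" "x < h" and "\<And>z. z \<in> set ys \<Longrightarrow> z < h \<Longrightarrow> z < x"
  shows "card {y \<in> set (h # ys). y < x} = card {y \<in> set ys. y < h}"
proof -
  have "{y \<in> set (h # ys). y < x} = {y \<in> set ys. y < h}"
    using assms by auto
  then show ?thesis by simp
qed

lemma lehmer_hd_greater: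
  fixes x h :: nat
  assumes "distinct (x # h # ys)" "h < x"
  shows "card {y \<in> set (h # ys). y < x} = Suc (card {y \<in> set ys. y < h} + card {y \<in> set ys. h < y \<and> y < x})"
proof -
  have "{y \<in> set (h # ys). y < x} = insert h ({y \<in> set ys. y < h} \<union> {y \<in> set ys. h < y \<and> y < x})"
    using assms by auto
  then show ?thesis
    using assms by (auto simp: card_insert_if card_Un_disjoint disjoint_iff)
qed

text \<open>A 132 beginning with \<open>x\<close> can be moved to begin with \<open>h\<close>, so
  the tail would contain one too. This is immediate if \<open>h < x\<close>; if
  \<open>x < h\<close>, the inequality leaves no later value between \<open>x\<close> and
  \<open>h\<close>, so the 2 and the 3 both exceed \<open>h\<close>.\<close>

lemma avoids_132_Cons:
  assumes "distinct (x # h # ys)"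
  shows "avoids (x # h # ys) [1, 3, 2] \<longleftrightarrow> avoids (h # ys) [1, 3, 2] \<and>
    card {y \<in> set ys. y < h} \<le> card {y \<in> set (h # ys). y < x}"
    (is "?L \<longleftrightarrow> ?A \<and> ?le")
proof
  assume L: ?L
  then have ?A by (rule avoids_ConsD)
  moreover have ?le
  proof (cases "x < h")
    case True
    have "z < x" if "z \<in> set ys" "z < h" for z
      using avoids_132_less_hd[OF assms L True] that by blast
    then show ?thesis using lehmer_hd_less[OF assms True] by simp
  next
    case False
    then show ?thesis using assms lehmer_hd_greater[of x h ys] by auto
  qed
  ultimately show "?A \<and> ?le" ..
next
  assume R: "?A \<and> ?le"
  have none: "\<not> (subseq [b, c] (h # ys) \<and> x < c \<and> c < b)" for b c
  proof
    assume bc: "subseq [b, c] (h # ys) \<and> x < c \<and> c < b"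
    then have mem: "b \<in> set (h # ys)" "c \<in> set ys" and sub: "b \<noteq> h \<Longrightarrow> subseq [b, c] ys"
      by (auto dest: subseq2_set)
    show False
    proof (cases "x < h")
      case True
      have "{y \<in> set (h # ys). y < x} \<subseteq> {y \<in> set ys. y < h}" using True by auto
      moreover have "card {y \<in> set ys. y < h} \<le> card {y \<in> set (h # ys). y < x}" using R ..
      \<comment> \<open>The left set is contained in the right one and at least as large.\<close>
      ultimately have eq: "{y \<in> set (h # ys). y < x} = {y \<in> set ys. y < h}"
        by (intro card_seteq) auto
      have "\<not> c < h" using eq mem bc by (auto dest: less_asym)
      then have "h < c" using assms mem by (auto simp: not_less order_le_less)
      then have "subseq [h, b, c] (h # ys)" using sub bc by auto
      then show False using R bc \<open>h < c\<close> unfolding avoids_132 by blast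
    next
      case False
      then have "h < x" using assms by auto
      then have "subseq [h, b, c] (h # ys)" using sub bc by auto
      then show False using R bc \<open>h < x\<close> unfolding avoids_132 by (meson less_trans)
    qed
  qed
  show ?L by (rule avoids_132_ConsI) (use R none in blast)+
qed

text \<open>Equal codes force the ascent \<open>x < h\<close>, and positivity supplies a smaller
  entry after it. Conversely, if a 231 begins with \<open>x\<close> and \<open>h < x\<close>, then
  its 1 is below \<open>h\<close>, as otherwise \<open>h\<close> would begin a 132; so
  \<open>h\<close> can replace \<open>x\<close>.\<close>

lemma avoids_132_231_Cons:
  assumes dist: "distinct (x # h # ys)" and av: "avoids (x # h # ys) [1, 3, 2]"
  shows "avoids (x # h # ys) [2, 3, 1] \<longleftrightarrow> avoids (h # ys) [2, 3, 1] \<and>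
    \<not> (card {y \<in> set (h # ys). y < x} = card {y \<in> set ys. y < h} \<and> 0 < card {y \<in> set (h # ys). y < x})"
    (is "?L \<longleftrightarrow> ?A \<and> \<not> ?eq")
proof
  assume L: ?L
  then have ?A by (rule avoids_ConsD)
  moreover have "\<not> ?eq"
  proof
    assume eq: ?eq
    then have xh: "x < h" using dist lehmer_hd_greater[of x h ys] by (cases x h rule: linorder_cases) auto
    obtain z where "z \<in> set (h # ys)" "z < x" using eq by (auto simp: card_gt_0_iff)
    then have "z \<in> set ys" using xh by auto
    then have "subseq [x, h, z] (x # h # ys)" by (simp add: subseq_singleton_left)
    then show False using L xh \<open>z < x\<close> unfolding avoids_231 by blast
  qed
  ultimately show "?A \<and> \<not> ?eq" ..
next
  assume R: "?A \<and> \<not> ?eq"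
  have none: "\<not> (subseq [b, c] (h # ys) \<and> c < x \<and> x < b)" for b c
  proof
    assume bc: "subseq [b, c] (h # ys) \<and> c < x \<and> x < b"
    then have mem: "c \<in> set ys" and sub: "b \<noteq> h \<Longrightarrow> subseq [b, c] ys"
      by (auto dest: subseq2_set)
    show False
    proof (cases "x < h")
      case True
      have "z < x" if "z \<in> set ys" "z < h" for z
        using avoids_132_less_hd[OF dist av True] that by blast
      then have "card {y \<in> set (h # ys). y < x} = card {y \<in> set ys. y < h}"
        using lehmer_hd_less[OF dist True] by simp
      moreover have "c \<in> {y \<in> set (h # ys). y < x}" using mem bc by simp
      then have "0 < card {y \<in> set (h # ys). y < x}" by (subst card_gt_0_iff) auto
      ultimately show False using R by blast
    next
      case False
      then have "h < x" using dist by auto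
      then have *: "subseq [h, b, c] (h # ys)" using sub bc by auto
      have "c \<noteq> h" using dist mem by auto
      have "avoids (h # ys) [1, 3, 2]" using av by (rule avoids_ConsD)
      then have "\<not> h < c" using * bc unfolding avoids_132 by (meson less_trans)
      then have "c < h" using \<open>c \<noteq> h\<close> by simp
      then show False using R * bc \<open>h < x\<close> unfolding avoids_231 by (meson less_trans)
    qed
  qed
  show ?L by (rule avoids_231_ConsI) (use R none in blast)+
qed

text \<open>A drop by more than 1 yields a later value \<open>w\<close> strictly between
  \<open>h\<close> and \<open>x\<close>. Given a 231 in the tail, either \<open>x\<close> lies above
  it, or \<open>x\<close>, \<open>h\<close>, \<open>w\<close> and the 1 of that 231 form a 4231.
  Conversely, if the drop is at most 1, the 4 of an occurrence can be moved from \<open>x\<close> to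
  \<open>h\<close>: either \<open>x < h\<close>, or no later value lies between them.\<close>

lemma avoids_132_4231_Cons:
  assumes dist: "distinct (x # h # ys)" and av: "avoids (x # h # ys) [1, 3, 2]"
  shows "avoids (x # h # ys) [4, 2, 3, 1] \<longleftrightarrow> avoids (h # ys) [4, 2, 3, 1] \<and>
    (avoids (h # ys) [2, 3, 1] \<or> card {y \<in> set (h # ys). y < x} \<le> Suc (card {y \<in> set ys. y < h}))"
    (is "?L \<longleftrightarrow> ?A \<and> (?B \<or> ?le)")
proof
  assume L: ?L
  then have ?A by (rule avoids_ConsD)
  moreover have ?B if gt: "\<not> ?le"
    unfolding avoids_231
  proof safe
    fix a b c assume sub: "subseq [a, b, c] (h # ys)" and less: "c < a" "a < b"
    have bc: "subseq [b, c] ys"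
      using sub by (auto intro: subseq_Cons')
    have "avoids (h # ys) [1, 3, 2]" using av by (rule avoids_ConsD)
    then have av': "\<not> (subseq [h, u, v] (h # ys) \<and> h < v \<and> v < u)" for u v
      unfolding avoids_132 by blast
    have hx: "h < x"
    proof (rule ccontr)
      assume "\<not> h < x"
      then have "x < h" using dist by auto
      moreover have "z < x" if "z \<in> set ys" "z < h" for z
        using avoids_132_less_hd[OF dist av \<open>x < h\<close>] that by blast
      ultimately show False using gt lehmer_hd_less[OF dist] by simp
    qed
    then have "card {y \<in> set ys. h < y \<and> y < x} > 0"
      using gt lehmer_hd_greater[OF dist hx] by linarith
    then obtain w where w: "w \<in> set ys" "h < w" "w < x" by (auto simp: card_gt_0_iff)
    show False
    proof (cases "b < x")
      case True
      have "subseq [x, a, b, c] (x # h # ys)" using sub by simp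
      then show False using L True less unfolding avoids_4231 by blast
    next
      case False
      have "b \<in> set ys" using bc by (auto dest: subseq2_set)
      then have "b \<noteq> x" using dist by auto
      with False have "x < b" by simp
      have "b \<noteq> w" using w \<open>x < b\<close> by simp
      \<comment> \<open>Otherwise \<open>h\<close>, \<open>b\<close>, \<open>w\<close> would be a
        132, because \<open>h < w < b\<close>. So \<open>w\<close> stands before \<open>b\<close>
        and hence before \<open>c\<close>.\<close>
      have "\<not> subseq [b, w] ys" using av'[of b w] w \<open>x < b\<close> by auto
      have "h \<noteq> c" using bc dist by (auto dest: subseq2_set)
      have "\<not> h < c" using av'[of b c] bc less by auto
      then have "c < h" using \<open>h \<noteq> c\<close> by simp
      have "subseq [w, c] ys"
        using \<open>\<not> subseq [b, w] ys\<close> bc w(1) \<open>b \<noteq> w\<close>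
        by (induction ys) (auto dest: subseq2_set)
      then have "subseq [x, h, w, c] (x # h # ys)" by simp
      then show False using L w \<open>c < h\<close> unfolding avoids_4231 by blast
    qed
  qed
  ultimately show "?A \<and> (?B \<or> ?le)" by blast
next
  assume R: "?A \<and> (?B \<or> ?le)"
  have none: "\<not> (subseq [a, b, c] (h # ys) \<and> c < a \<and> a < b \<and> b < x)" for a b c
  proof
    assume *: "subseq [a, b, c] (h # ys) \<and> c < a \<and> a < b \<and> b < x"
    then have "\<not> ?B" unfolding avoids_231 by blast
    with R have le: ?le by blast
    have A: "\<not> (subseq [h, a, b, c] (h # ys) \<and> b < h)"
      using R * unfolding avoids_4231 by blast
    have bc: "subseq [b, c] ys"
      using * by (auto intro: subseq_Cons')
    show False
    proof (cases "x < h")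
      case True
      then have "subseq [a, b, c] ys" using * by auto
      then show False using A True * by auto
    next
      case False
      then have hx: "h < x" using dist by auto
      then have "card {y \<in> set ys. h < y \<and> y < x} = 0"
        using le lehmer_hd_greater[OF dist hx] by simp
      then have no: "\<not> (h < y \<and> y < x)" if "y \<in> set ys" for y using that by auto
      have "b \<in> set ys" using bc by (auto dest: subseq2_set)
      moreover have "b \<noteq> h" using \<open>b \<in> set ys\<close> dist by auto
      ultimately have "b < h" using no[of b] * by auto
      then have "subseq [a, b, c] ys" using * by auto
      then show False using A \<open>b < h\<close> by auto
    qed
  qed
  show ?L by (rule avoids_4231_ConsI) (use R none in blast)+
qed

lemma avoids_short: "length p < length q \<Longrightarrow> avoids p q"
  by (force simp: avoids_def order_isomorphic_def dest: list_emb_length)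

lemma has_repeat_lehmer:
  "distinct p \<Longrightarrow> avoids p [1, 3, 2] \<Longrightarrow> has_repeat (lehmer p) \<longleftrightarrow> \<not> avoids p [2, 3, 1]"
proof (induction p rule: induct_list012)
  case (3 x h ys)
  have "avoids (h # ys) [1, 3, 2]" using 3 avoids_132_Cons by blast
  moreover have "has_repeat (lehmer (x # h # ys)) \<longleftrightarrow>
      card {y \<in> set (h # ys). y < x} = card {y \<in> set ys. y < h} \<and> 0 < card {y \<in> set (h # ys). y < x} \<or>
      has_repeat (lehmer (h # ys))"
    by (simp only: lehmer.simps has_repeat.simps)
  moreover have "distinct (h # ys)" using "3.prems" by simp
  ultimately show ?case using "3.IH"(2) avoids_132_231_Cons[OF "3.prems"] by blast
qed (simp_all add: avoids_short)

lemma good_code_lehmer: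
  "distinct p \<Longrightarrow> good_code (lehmer p) \<longleftrightarrow> avoids p [1, 3, 2] \<and> avoids p [4, 2, 3, 1]"
proof (induction p rule: induct_list012)
  case (3 x h ys)
  have "distinct (h # ys)" using 3 by simp
  note IH = "3.IH"(2)[OF this] and rep = has_repeat_lehmer[OF this]
  have good: "good_code (lehmer (x # h # ys)) \<longleftrightarrow> good_code (lehmer (h # ys)) \<and>
      card {y \<in> set ys. y < h} \<le> card {y \<in> set (h # ys). y < x} \<and>
      (has_repeat (lehmer (h # ys)) \<longrightarrow>
        card {y \<in> set (h # ys). y < x} \<le> Suc (card {y \<in> set ys. y < h}))"
    by (simp only: lehmer.simps good_code.simps)
  show ?case
  proof (cases "avoids (x # h # ys) [1, 3, 2]")
    case True
    then show ?thesis
      using IH rep good avoids_132_Cons[OF "3.prems"] avoids_132_4231_Cons[OF "3.prems"] by blast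
  next
    case False
    then show ?thesis
      using IH good avoids_132_Cons[OF "3.prems"] by blast
  qed
qed (simp_all add: avoids_short)

section \<open>Weight enumerators\<close>

text \<open>Since \<open>card\<close> is 0 on infinite sets, an infinite fibre would be lost; the
  sum and product rules therefore assume finite fibres.\<close>

definition weight_enum :: "('a \<Rightarrow> nat) \<Rightarrow> 'a set \<Rightarrow> int fps" where
  "weight_enum w S = Abs_fps (\<lambda>k. int (card {x \<in> S. w x = k}))"

lemma weight_enum_nth [simp]: "fps_nth (weight_enum w S) k = int (card {x \<in> S. w x = k})"
  by (simp add: weight_enum_def)

lemma weight_enum_bij_betw:
  assumes "bij_betw f S T" and "\<And>x. x \<in> S \<Longrightarrow> w' (f x) = w x + m"
  shows "weight_enum w' T = fps_X ^ m * weight_enum w S"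
proof (rule fps_ext)
  fix k
  have "{y \<in> T. w' y = k} = f ` {x \<in> S. w x + m = k}"
    using assms by (auto simp: bij_betw_def)
  moreover have "inj_on f {x \<in> S. w x + m = k}"
    using assms(1) by (auto simp: bij_betw_def inj_on_def)
  ultimately have "card {y \<in> T. w' y = k} = card {x \<in> S. w x + m = k}"
    by (simp add: card_image)
  moreover have "{x \<in> S. w x + m = k} = (if k < m then {} else {x \<in> S. w x = k - m})"
    by auto
  ultimately show "fps_nth (weight_enum w' T) k = fps_nth (fps_X ^ m * weight_enum w S) k"
    by (simp add: fps_X_power_mult_nth)
qed

lemma weight_enum_Un:
  assumes "\<And>k. finite {x \<in> S. w x = k}" "\<And>k. finite {x \<in> T. w x = k}" "S \<inter> T = {}"
  shows "weight_enum w (S \<union> T) = weight_enum w S + weight_enum w T"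
proof (rule fps_ext)
  fix k
  have "{x \<in> S \<union> T. w x = k} = {x \<in> S. w x = k} \<union> {x \<in> T. w x = k}" by auto
  moreover have "{x \<in> S. w x = k} \<inter> {x \<in> T. w x = k} = {}" using assms(3) by auto
  ultimately show "fps_nth (weight_enum w (S \<union> T)) k = fps_nth (weight_enum w S + weight_enum w T) k"
    using assms by (simp add: card_Un_disjoint)
qed

lemma weight_enum_Times:
  assumes "\<And>k. finite {x \<in> S. w x = k}" "\<And>k. finite {y \<in> T. w' y = k}"
  shows "weight_enum (\<lambda>(x, y). w x + w' y) (S \<times> T) = weight_enum w S * weight_enum w' T"
proof (rule fps_ext)
  fix k
  have "{p \<in> S \<times> T. (case p of (x, y) \<Rightarrow> w x + w' y) = k} =
      (\<Union>i\<in>{0..k}. {x \<in> S. w x = i} \<times> {y \<in> T. w' y = k - i})"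
    by auto
  also have "card \<dots> = (\<Sum>i=0..k. card ({x \<in> S. w x = i} \<times> {y \<in> T. w' y = k - i}))"
    using assms by (intro card_UN_disjoint) auto
  finally show "fps_nth (weight_enum (\<lambda>(x, y). w x + w' y) (S \<times> T)) k =
      fps_nth (weight_enum w S * weight_enum w' T) k"
    by (simp add: fps_mult_nth card_cartesian_product)
qed

lemma finite_length_sum_list: "finite {xs :: nat list. length xs = n \<and> sum_list xs = k}"
proof (rule finite_subset)
  show "finite {xs. set xs \<subseteq> {..k} \<and> length xs = n}" by (rule finite_lists_length_eq) simp
qed (auto intro: member_le_sum_list)

lemma length_le_sum_list: "0 \<notin> set xs \<Longrightarrow> length xs \<le> sum_list (xs :: nat list)"
  by (induction xs) auto

lemma finite_pos_sum_list: "finite {xs :: nat list. 0 \<notin> set xs \<and> sum_list xs = k}"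
proof (rule finite_subset)
  show "finite (\<Union>n\<in>{..k}. {xs :: nat list. length xs = n \<and> sum_list xs = k})"
    by (intro finite_UN_I finite_length_sum_list) simp
qed (auto dest: length_le_sum_list)

text \<open>The initial part of a partition up to the first of the last two equal parts \<open>v\<close>; subtracting \<open>v\<close>
  from its parts leaves the conjugate of a partition into distinct parts of size at most \<open>a\<close>.\<close>

definition slow_lists :: "nat \<Rightarrow> nat \<Rightarrow> nat list set" where
  "slow_lists a v = {P. length P = Suc a \<and> last P = v \<and> successively (\<lambda>x y. x = y \<or> x = Suc y) P}"

definition strict_lists :: "nat \<Rightarrow> nat list set" where
  "strict_lists b = {T. sorted_wrt (>) T \<and> set T \<subseteq> {1..b}}"

lemma finite_slow_lists: "finite {P \<in> slow_lists a v. sum_list P = k}"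
  by (rule finite_subset[OF _ finite_length_sum_list[of "Suc a" k]]) (auto simp: slow_lists_def)

lemma finite_strict_lists: "finite {T \<in> strict_lists b. sum_list T = k}"
  by (rule finite_subset[OF _ finite_pos_sum_list[of k]]) (auto simp: strict_lists_def)

lemma slow_lists_0: "slow_lists 0 v = {[v]}"
  by (auto simp: slow_lists_def length_Suc_conv)

text \<open>The entry before the final \<open>v\<close> is \<open>v\<close> or
  \<open>Suc v\<close>.\<close>

lemma slow_lists_Suc: "slow_lists (Suc a) v = (\<lambda>P. P @ [v]) ` (slow_lists a v \<union> slow_lists a (Suc v))"
proof (rule set_eqI)
  fix Q :: "nat list"
  show "Q \<in> slow_lists (Suc a) v \<longleftrightarrow> Q \<in> (\<lambda>P. P @ [v]) ` (slow_lists a v \<union> slow_lists a (Suc v))"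
    by (cases Q rule: rev_cases) (auto simp: slow_lists_def successively_append_iff)
qed

text \<open>In the recursion the two choices carry the exponents \<open>v * Suc a\<close> and
  \<open>Suc v * Suc a\<close>. These differ by \<open>Suc a\<close>, which produces the new factor
  \<open>1 + fps_X ^ Suc a\<close>.\<close>

lemma weight_enum_slow_lists:
  "weight_enum sum_list (slow_lists a v) = fps_X ^ (v * Suc a) * (\<Prod>i=1..a. 1 + fps_X ^ i)"
proof (induction a arbitrary: v)
  case 0
  have "{x. x = [v] \<and> sum_list x = k} = (if k = v then {[v]} else {})" for k by auto
  then show ?case by (simp add: slow_lists_0 fps_eq_iff)
next
  case (Suc a)
  have "bij_betw (\<lambda>P. P @ [v]) (slow_lists a v \<union> slow_lists a (Suc v)) (slow_lists (Suc a) v)"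
    by (simp add: slow_lists_Suc bij_betw_def inj_on_def)
  then have "weight_enum sum_list (slow_lists (Suc a) v) =
      fps_X ^ v * weight_enum sum_list (slow_lists a v \<union> slow_lists a (Suc v))"
    by (rule weight_enum_bij_betw) simp
  also have "weight_enum sum_list (slow_lists a v \<union> slow_lists a (Suc v)) =
      weight_enum sum_list (slow_lists a v) + weight_enum sum_list (slow_lists a (Suc v))"
    by (intro weight_enum_Un finite_slow_lists) (auto simp: slow_lists_def)
  finally show ?case
    by (simp add: Suc.IH algebra_simps power_add)
qed

lemma strict_lists_0: "strict_lists 0 = {[]}"
  by (auto simp: strict_lists_def)

text \<open>The largest admissible part is either absent or comes first; this gives the factor
  \<open>1 + fps_X ^ Suc b\<close> below.\<close>

lemma strict_lists_Suc: "strict_lists (Suc b) = strict_lists b \<union> (#) (Suc b) ` strict_lists b"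
proof (rule set_eqI)
  fix T :: "nat list"
  show "T \<in> strict_lists (Suc b) \<longleftrightarrow> T \<in> strict_lists b \<union> (#) (Suc b) ` strict_lists b"
    by (cases T) (fastforce simp: strict_lists_def image_iff)+
qed

lemma weight_enum_strict_lists: "weight_enum sum_list (strict_lists b) = (\<Prod>i=1..b. 1 + fps_X ^ i)"
proof (induction b)
  case 0
  have "{x. x = [] \<and> sum_list x = k} = (if k = 0 then {[]} else {})" for k :: nat by auto
  then show ?case by (simp add: strict_lists_0 fps_eq_iff)
next
  case (Suc b)
  have "weight_enum sum_list (strict_lists (Suc b)) =
      weight_enum sum_list (strict_lists b) + weight_enum sum_list ((#) (Suc b) ` strict_lists b)"
    unfolding strict_lists_Suc
  proof (intro weight_enum_Un finite_strict_lists)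
    show "finite {x \<in> (#) (Suc b) ` strict_lists b. sum_list x = k}" for k
      by (rule finite_subset[OF _ finite_strict_lists[of "Suc b" k]]) (auto simp: strict_lists_Suc)
  qed (auto simp: strict_lists_def)
  also have "weight_enum sum_list ((#) (Suc b) ` strict_lists b) =
      fps_X ^ Suc b * weight_enum sum_list (strict_lists b)"
    by (rule weight_enum_bij_betw[of "(#) (Suc b)"]) (auto simp: bij_betw_def)
  finally show ?case
    by (simp add: Suc.IH algebra_simps)
qed

section \<open>Decomposition of good codes at the last repeat\<close>

definition good_parts :: "nat list set" where
  "good_parts = {c. good_code c \<and> 0 \<notin> set c}"

text \<open>The last entry of \<open>P\<close> and the explicit \<open>Suc b\<close> form the last
  repeat. The first \<open>a + 2\<close> parts are at least \<open>b + 1\<close>, which is the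
  rectangle.\<close>

definition repeat_lists :: "nat \<Rightarrow> nat \<Rightarrow> nat list set" where
  "repeat_lists a b = (\<lambda>(P, T). P @ [Suc b] @ T) ` (slow_lists a (Suc b) \<times> strict_lists b)"

lemma repeat_listsI: "P \<in> slow_lists a (Suc b) \<Longrightarrow> T \<in> strict_lists b \<Longrightarrow> P @ [Suc b] @ T \<in> repeat_lists a b"
  by (force simp: repeat_lists_def)

text \<open>Without a repeat the bound on drops is vacuous, and weak decrease becomes strict. Zeros
  are excluded because \<open>has_repeat\<close> ignores equal zeros.\<close>

lemma good_code_no_repeat_iff:
  "0 \<notin> set c \<Longrightarrow> good_code c \<and> \<not> has_repeat c \<longleftrightarrow> sorted_wrt (>) c"
proof -
  have "0 \<notin> set c \<Longrightarrow> good_code c \<and> \<not> has_repeat c \<longleftrightarrow> successively (>) c"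
    by (induction c rule: induct_list012) auto
  moreover have "successively (>) c \<longleftrightarrow> sorted_wrt (>) c"
    by (rule successively_conv_sorted_wrt) (auto simp: transp_def)
  ultimately show "0 \<notin> set c \<Longrightarrow> good_code c \<and> \<not> has_repeat c \<longleftrightarrow> sorted_wrt (>) c" by blast
qed

lemma sorted_wrt_strict_listsD:
  assumes "T \<in> strict_lists b"
  shows "sorted_wrt (>) (Suc b # T)" "0 \<notin> set (Suc b # T)"
  using assms by (auto simp: strict_lists_def)

text \<open>Read from right to left, \<open>Suc b # T\<close> is strictly decreasing, the next
  \<open>Suc b\<close> creates the repeat, and from there on the steps of a slow list are just the
  drops that \<open>good_code\<close> permits.\<close>

lemma slow_lists_append_good:
  assumes "P \<in> slow_lists a (Suc b)" "T \<in> strict_lists b"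
  shows "good_code (P @ [Suc b] @ T) \<and> has_repeat (P @ [Suc b] @ T) \<and> 0 \<notin> set (P @ [Suc b] @ T)"
  using assms(1)
proof (induction P arbitrary: a rule: induct_list012)
  case 1
  then show ?case by (simp add: slow_lists_def)
next
  case (2 x)
  then have "x = Suc b" by (simp add: slow_lists_def)
  then show ?case
    using sorted_wrt_strict_listsD[OF assms(2)] good_code_no_repeat_iff[of "Suc b # T"] by auto
next
  case (3 x y P)
  from "3.prems" have "y # P \<in> slow_lists (a - 1) (Suc b)" and xy: "x = y \<or> x = Suc y"
    by (auto simp: slow_lists_def)
  with "3.IH"(2) have "good_code (y # P @ [Suc b] @ T) \<and> has_repeat (y # P @ [Suc b] @ T) \<and>
      0 \<notin> set (y # P @ [Suc b] @ T)"
    by simp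
  then show ?case using xy by auto
qed

text \<open>Scanning from the left: while the tail still has a repeat, the first entry exceeds the
  second by at most 1 and can be put in front of \<open>P\<close>. Once the tail has none, the first
  two entries are the last repeat.\<close>

lemma good_code_repeatE:
  assumes "good_code c" "has_repeat c" "0 \<notin> set c"
  shows "\<exists>a b. c \<in> repeat_lists a b"
  using assms
proof (induction c rule: induct_list012)
  case (3 c d cs)
  show ?case
  proof (cases "has_repeat (d # cs)")
    case True
    then obtain a b P T where *: "d # cs = P @ [Suc b] @ T" "P \<in> slow_lists a (Suc b)" "T \<in> strict_lists b"
      using 3 by (auto simp: repeat_lists_def)
    then obtain P' where P': "P = d # P'"
      by (cases P) (auto simp: slow_lists_def)
    have "c = d \<or> c = Suc d" using 3 True by auto
    then have "c # P \<in> slow_lists (Suc a) (Suc b)"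
      using * P' by (auto simp: slow_lists_def)
    then have "(c # P) @ [Suc b] @ T \<in> repeat_lists (Suc a) b"
      using *(3) by (rule repeat_listsI)
    then show ?thesis using *(1) by (metis append_Cons)
  next
    case False
    then have cd: "c = d" using "3.prems" by auto
    obtain b where b: "c = Suc b" using "3.prems" by (cases c) auto
    have sorted: "sorted_wrt (>) (d # cs)" using 3 False good_code_no_repeat_iff[of "d # cs"] by auto
    have "set cs \<subseteq> {1..b}"
    proof
      fix x assume "x \<in> set cs"
      then have "x < Suc b" using sorted cd b by auto
      moreover have "x \<noteq> 0" using \<open>x \<in> set cs\<close> "3.prems"(3) by (cases "x = 0") auto
      ultimately show "x \<in> {1..b}" by simp
    qed
    with sorted have "cs \<in> strict_lists b" by (simp add: strict_lists_def)
    then have "[Suc b] @ [Suc b] @ cs \<in> repeat_lists 0 b"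
      by (intro repeat_listsI) (auto simp: slow_lists_0)
    then show ?thesis using cd b by auto
  qed
qed auto

lemma good_parts_eq: "good_parts = {c. sorted_wrt (>) c \<and> 0 \<notin> set c} \<union> (\<Union>(a, b). repeat_lists a b)"
proof (rule set_eqI)
  fix c
  have "c \<in> good_parts \<longleftrightarrow> 0 \<notin> set c \<and> (good_code c \<and> \<not> has_repeat c \<or> good_code c \<and> has_repeat c)"
    by (auto simp: good_parts_def)
  also have "\<dots> \<longleftrightarrow> 0 \<notin> set c \<and> sorted_wrt (>) c \<or> (\<exists>a b. c \<in> repeat_lists a b)"
    using good_code_no_repeat_iff[of c] good_code_repeatE[of c] slow_lists_append_good
    by (auto simp: repeat_lists_def)
  finally show "c \<in> good_parts \<longleftrightarrow> c \<in> {c. sorted_wrt (>) c \<and> 0 \<notin> set c} \<union> (\<Union>(a, b). repeat_lists a b)"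
    by auto
qed

text \<open>If the marked pairs stood at different places, the one further right would lie inside
  the strictly decreasing part of the other decomposition.\<close>

lemma last_repeat_unique:
  fixes v w :: nat
  assumes "xs @ [v, v] @ T = ys @ [w, w] @ U" "sorted_wrt (>) (v # T)" "sorted_wrt (>) (w # U)"
  shows "xs = ys \<and> v = w \<and> T = U"
  using assms
proof (induction xs arbitrary: ys)
  case Nil
  show ?case
  proof (cases ys)
    case (Cons y zs)
    with Nil show ?thesis by (cases zs) (auto simp: sorted_wrt_append)
  qed (use Nil in auto)
next
  case (Cons x xs)
  show ?case
  proof (cases ys)
    case Nil
    with Cons.prems show ?thesis by (cases xs) (auto simp: sorted_wrt_append)
  next
    case (Cons y zs)
    with Cons.prems have "x = y" "xs @ [v, v] @ T = zs @ [w, w] @ U" by auto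
    with Cons.IH Cons.prems(2,3) \<open>ys = y # zs\<close> show ?thesis by blast
  qed
qed

lemma slow_lists_split: "P \<in> slow_lists a v \<Longrightarrow> \<exists>Q. P = Q @ [v] \<and> length Q = a"
  by (cases P rule: rev_cases) (auto simp: slow_lists_def)

lemma repeat_lists_unique:
  assumes "P @ [Suc b] @ T = P' @ [Suc b'] @ T'" "P \<in> slow_lists a (Suc b)" "T \<in> strict_lists b"
    "P' \<in> slow_lists a' (Suc b')" "T' \<in> strict_lists b'"
  shows "a = a' \<and> b = b' \<and> P = P' \<and> T = T'"
proof -
  obtain Q Q' where Q: "P = Q @ [Suc b]" "length Q = a" "P' = Q' @ [Suc b']" "length Q' = a'"
    using slow_lists_split assms by metis
  then have "Q = Q' \<and> Suc b = Suc b' \<and> T = T'"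
    using assms by (intro last_repeat_unique sorted_wrt_strict_listsD) auto
  with Q show ?thesis by auto
qed

lemma repeat_lists_disjoint:
  assumes "(a, b) \<noteq> (a', b')"
  shows "repeat_lists a b \<inter> repeat_lists a' b' = {}"
proof (rule ccontr)
  assume "repeat_lists a b \<inter> repeat_lists a' b' \<noteq> {}"
  then obtain c where "c \<in> repeat_lists a b" "c \<in> repeat_lists a' b'" by blast
  then obtain P T P' T' where "P \<in> slow_lists a (Suc b)" "T \<in> strict_lists b"
    "P' \<in> slow_lists a' (Suc b')" "T' \<in> strict_lists b'" "P @ [Suc b] @ T = P' @ [Suc b'] @ T'"
    unfolding repeat_lists_def by fast
  from repeat_lists_unique[OF this(5,1,2,3,4)] assms show False by simp
qed

lemma weight_enum_repeat_lists:
  "weight_enum sum_list (repeat_lists a b) =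
    fps_X ^ ((a + 2) * (b + 1)) * (\<Prod>i=1..a. 1 + fps_X ^ i) * (\<Prod>i=1..b. 1 + fps_X ^ i)"
proof -
  have "inj_on (\<lambda>(P, T). P @ [Suc b] @ T) (slow_lists a (Suc b) \<times> strict_lists b)"
  proof (rule inj_onI, clarify)
    fix P T P' T'
    assume "P @ [Suc b] @ T = P' @ [Suc b] @ T'" "P \<in> slow_lists a (Suc b)" "T \<in> strict_lists b"
      "P' \<in> slow_lists a (Suc b)" "T' \<in> strict_lists b"
    from repeat_lists_unique[OF this] show "P = P' \<and> T = T'" by simp
  qed
  then have "bij_betw (\<lambda>(P, T). P @ [Suc b] @ T) (slow_lists a (Suc b) \<times> strict_lists b) (repeat_lists a b)"
    by (simp add: bij_betw_def repeat_lists_def)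
  then have "weight_enum sum_list (repeat_lists a b) = fps_X ^ Suc b *
      weight_enum (\<lambda>(P, T). sum_list P + sum_list T) (slow_lists a (Suc b) \<times> strict_lists b)"
    by (rule weight_enum_bij_betw) auto
  also have "weight_enum (\<lambda>(P, T). sum_list P + sum_list T) (slow_lists a (Suc b) \<times> strict_lists b) =
      weight_enum sum_list (slow_lists a (Suc b)) * weight_enum sum_list (strict_lists b)"
    by (intro weight_enum_Times finite_slow_lists finite_strict_lists)
  also have "fps_X ^ Suc b * \<dots> = fps_X ^ (Suc b + Suc b * Suc a) * (\<Prod>i=1..a. 1 + fps_X ^ i) *
      (\<Prod>i=1..b. 1 + fps_X ^ i)"
    unfolding weight_enum_slow_lists weight_enum_strict_lists power_add by (simp only: mult.assoc)
  \<comment> \<open>The slow list contributes \<open>a + 1\<close> rows of the rectangle and the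
    second copy of \<open>Suc b\<close> one more.\<close>
  also have "Suc b + Suc b * Suc a = (a + 2) * (b + 1)" by simp
  finally show ?thesis .
qed

section \<open>Coefficients of the infinite product and sum\<close>

lemma fps_nth_prodinf_one_plus_X_power:
  assumes "k \<le> n"
  shows "fps_nth (\<Prod>i=1..n. 1 + fps_X ^ i :: int fps) k =
    fps_nth (\<Prod>i. 1 + fps_X ^ (i + 1) :: int fps) k"
proof -
  define Q :: "nat \<Rightarrow> int fps" where "Q n = (\<Prod>i=1..n. 1 + fps_X ^ i)" for n
  define L where "L = Abs_fps (\<lambda>k. fps_nth (Q k) k)"
  have Q_Suc: "Q (Suc n) = Q n + fps_X ^ Suc n * Q n" for n
    by (simp add: Q_def algebra_simps)
  \<comment> \<open>The factor with index \<open>Suc n\<close> changes no coefficient up to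
    \<open>n\<close>.\<close>
  have stable: "fps_nth (Q n) k = fps_nth L k" if "k \<le> n" for k n
    using that
  proof (induction n rule: dec_induct)
    case (step n)
    then show ?case by (simp add: Q_Suc fps_X_power_mult_nth del: power_Suc)
  qed (simp add: L_def)
  \<comment> \<open>The infinite product is indexed from 0, so its partial product over
    \<open>{..n}\<close> has \<open>n + 1\<close> factors.\<close>
  have shift: "(\<Prod>i\<le>n. 1 + fps_X ^ (i + 1)) = Q (Suc n)" for n
    unfolding Q_def by (rule prod.reindex_bij_witness[of _ "\<lambda>i. i - 1" Suc]) auto
  have "(\<lambda>n. Q (Suc n)) \<longlonglongrightarrow> L"
    unfolding tendsto_fps_iff eventually_sequentially using stable le_SucI by blast
  \<comment> \<open>Convergence of an infinite product demands a nonzero limit; the constant term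
    shows this.\<close>
  moreover have "fps_nth L 0 = 1" by (simp add: L_def Q_def)
  then have "L \<noteq> 0" by auto
  ultimately have "(\<lambda>i. 1 + fps_X ^ (i + 1)) has_prod L"
    unfolding has_prod_def raw_has_prod_def add_0_right shift by blast
  then have "(\<Prod>i. 1 + fps_X ^ (i + 1)) = L"
    using has_prod_unique by blast
  then show ?thesis using stable[OF assms] by (simp add: Q_def)
qed

text \<open>In the X-adic topology every coefficient is eventually constant along the finite partial
  sums, so one coefficient of the infinite sum can be read off from a finite one.\<close>

lemma fps_nth_infsum:
  fixes f :: "'a \<Rightarrow> int fps"
  assumes "f summable_on A"
  shows "\<exists>F. finite F \<and> F \<subseteq> A \<and>
    (\<forall>G. finite G \<and> F \<subseteq> G \<and> G \<subseteq> A \<longrightarrow> fps_nth (sum f G) k = fps_nth (infsum f A) k)"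
proof -
  have "(sum f \<longlongrightarrow> infsum f A) (finite_subsets_at_top A)"
    using has_sum_infsum[OF assms] by (simp only: has_sum_def)
  then have "\<forall>\<^sub>F G in finite_subsets_at_top A. fps_nth (sum f G) k = fps_nth (infsum f A) k"
    by (simp only: tendsto_fps_iff)
  then show ?thesis
    by (simp only: eventually_finite_subsets_at_top)
qed

text \<open>For a fixed coefficient \<open>k\<close> only finitely many pairs contribute, so the
  disjoint decomposition \<open>good_parts_eq\<close> can be counted by finite
  cardinalities.\<close>

lemma weight_enum_good_parts:
  "weight_enum sum_list good_parts = (\<Prod>i. 1 + fps_X ^ (i + 1)) +
    (\<Sum>\<^sub>\<infinity>(a, b)\<in>UNIV. fps_X ^ ((a + 2) * (b + 1)) *
      (\<Prod>i=1..a. 1 + fps_X ^ i) * (\<Prod>i=1..b. 1 + fps_X ^ i))"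
    (is "_ = ?P + infsum ?t UNIV")
proof (rule fps_ext)
  fix k
  have summable: "?t summable_on UNIV"
    by (rule summable_on_X_power_times)
  obtain F where F: "finite F"
      "\<forall>G. finite G \<and> F \<subseteq> G \<and> G \<subseteq> UNIV \<longrightarrow> fps_nth (sum ?t G) k = fps_nth (infsum ?t UNIV) k"
    using fps_nth_infsum[OF summable, of k] by (elim exE conjE) (rule that)
  \<comment> \<open>\<open>F\<close> ensures that the partial sum over \<open>G\<close> has the
    right coefficient; the square contains every pair that admits a list of sum
    \<open>k\<close>.\<close>
  define G where "G = F \<union> {..k} \<times> {..k}"
  define R where "R = (\<lambda>(a, b). {c \<in> repeat_lists a b. sum_list c = k})"
  \<comment> \<open>A part of a partition of \<open>k\<close> is at most \<open>k\<close>, so this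
    bound on the parts loses nothing.\<close>
  define D where "D = {c \<in> strict_lists (k). sum_list c = k}"
  have [simp]: "finite G" using F by (simp add: G_def)
  have fin: "finite (R p)" for p
    by (cases p, rule finite_subset[OF _ finite_pos_sum_list[of k]])
      (auto simp: R_def repeat_lists_def dest: slow_lists_append_good)
  have t: "?t p = weight_enum sum_list (case p of (a, b) \<Rightarrow> repeat_lists a b)" for p
    by (cases p) (simp only: weight_enum_repeat_lists prod.case)
  have R: "fps_nth (?t p) k = int (card (R p))" for p
    unfolding t by (cases p) (simp add: R_def)
  \<comment> \<open>Outside the square the rectangle alone exceeds \<open>k\<close>. The coefficient
    then vanishes, and with it the finite cardinality.\<close>
  have empty: "R (a, b) = {}" if "(a, b) \<notin> G" for a b
  proof -
    have "k < (a + 2) * (b + 1)"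
    proof -
      from that have "k < a \<or> k < b" by (auto simp: G_def)
      then show ?thesis by (elim disjE) auto
    qed
    then have "fps_nth (?t (a, b)) k = 0"
      by (simp add: mult.assoc fps_X_power_mult_nth del: mult_Suc mult_Suc_right)
    then show ?thesis using R[of "(a, b)"] fin[of "(a, b)"] by simp
  qed
  have D_eq: "D = {c. sorted_wrt (>) c \<and> 0 \<notin> set c \<and> sum_list c = k}"
  proof -
    have "x \<le> k" if "x \<in> set c" "sum_list c = k" for x c
      using member_le_sum_list[OF that(1)] that(2) by simp
    then show ?thesis unfolding D_def strict_lists_def
      by (auto simp: subset_iff Suc_le_eq) (metis gr0I)
  qed
  have "{c \<in> good_parts. sum_list c = k} = D \<union> (\<Union>p. R p)"
    unfolding good_parts_eq D_eq by (auto simp: R_def)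
  also have "(\<Union>p. R p) = (\<Union>p\<in>G. R p)"
    using empty by (auto; blast)
  finally have eq: "{c \<in> good_parts. sum_list c = k} = D \<union> (\<Union>p\<in>G. R p)" .
  have "D \<inter> R p = {}" for p
  proof -
    have "\<not> has_repeat c" if "c \<in> D" for c
      using that good_code_no_repeat_iff[of c] by (auto simp: D_eq)
    moreover have "has_repeat c" if "c \<in> R p" for c
      using that slow_lists_append_good by (cases p) (auto simp: R_def repeat_lists_def)
    ultimately show ?thesis by blast
  qed
  moreover have "finite D" unfolding D_def by (rule finite_strict_lists)
  ultimately have "card {c \<in> good_parts. sum_list c = k} = card D + card (\<Union>p\<in>G. R p)"
    unfolding eq using fin by (intro card_Un_disjoint) auto
  also have "card (\<Union>p\<in>G. R p) = (\<Sum>p\<in>G. card (R p))"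
  proof (intro card_UN_disjoint ballI impI fin)
    fix p q :: "nat \<times> nat"
    assume "p \<noteq> q"
    then show "R p \<inter> R q = {}"
      using repeat_lists_disjoint[of "fst p" "snd p" "fst q" "snd q"]
      by (auto simp: R_def split_beta)
  qed simp
  finally have "int (card {c \<in> good_parts. sum_list c = k}) = int (card D) + (\<Sum>p\<in>G. fps_nth (?t p) k)"
    by (simp only: R of_nat_add of_nat_sum)
  also have "(\<Sum>p\<in>G. fps_nth (?t p) k) = fps_nth (infsum ?t UNIV) k"
    using F(2)[rule_format, of G] \<open>finite G\<close> unfolding fps_sum_nth[symmetric] by (simp only: G_def Un_upper1 subset_UNIV)
  also have "int (card D) = fps_nth (weight_enum sum_list (strict_lists (k))) k"
    by (simp add: D_def)
  also have "\<dots> = fps_nth ?P k"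
    unfolding weight_enum_strict_lists by (rule fps_nth_prodinf_one_plus_X_power) simp
  finally show "fps_nth (weight_enum sum_list good_parts) k = fps_nth (?P + infsum ?t UNIV) k"
    by simp
qed

section \<open>Permutations avoiding 132 and 4231\<close>

lemma order_isomorphic_map_strict_mono:
  "strict_mono f \<Longrightarrow> order_isomorphic (map f s) q \<longleftrightarrow> order_isomorphic s q"
  by (auto simp: order_isomorphic_def strict_mono_less)

lemma avoids_map_strict_mono:
  assumes "strict_mono f"
  shows "avoids (map f p) q \<longleftrightarrow> avoids p q"
proof -
  have "subseq s (map f p) \<longleftrightarrow> (\<exists>t. s = map f t \<and> subseq t p)" for s
    by (auto simp: subseq_conv_nths nths_map)
  then show ?thesis
    using order_isomorphic_map_strict_mono[OF assms] by (auto simp: avoids_def)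
qed

section \<open>Reverse complement\<close>

definition rev_complement :: "nat \<Rightarrow> nat list \<Rightarrow> nat list" where
  "rev_complement n p = rev (map (\<lambda>x. Suc n - x) p)"

lemma length_rev_complement [simp]: "length (rev_complement n p) = length p"
  by (simp add: rev_complement_def)

lemma rev_complement_nth:
  "i < length p \<Longrightarrow> rev_complement n p ! i = Suc n - p ! (length p - Suc i)"
  by (simp add: rev_complement_def rev_nth)

lemma rev_complement_nth_less_iff:
  assumes "set p \<subseteq> {1..n}" "i < length p" "j < length p"
  shows "rev_complement n p ! i < rev_complement n p ! j \<longleftrightarrow>
    p ! (length p - Suc j) < p ! (length p - Suc i)"
proof -
  have "length p - Suc i < length p" "length p - Suc j < length p" using assms by auto
  then have "p ! (length p - Suc i) \<in> {1..n}" "p ! (length p - Suc j) \<in> {1..n}"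
    using assms(1) nth_mem by blast+
  moreover have "Suc n - x < Suc n - y \<longleftrightarrow> y < x" if "x \<in> {1..n}" "y \<in> {1..n}" for x y
    using that by (simp only: atLeastAtMost_iff) arith
  ultimately show ?thesis
    unfolding rev_complement_nth[OF assms(2)] rev_complement_nth[OF assms(3)] by blast
qed

lemma set_rev_complement: "set p \<subseteq> {1..n} \<Longrightarrow> set (rev_complement n p) \<subseteq> {1..n}"
  by (auto simp: rev_complement_def subset_iff)

lemma rev_complement_involution:
  assumes "set p \<subseteq> {1..n}"
  shows "rev_complement n (rev_complement n p) = p"
proof -
  have "map (\<lambda>x. Suc n - (Suc n - x)) p = p"
    using assms by (intro map_idI) auto
  then show ?thesis by (simp add: rev_complement_def rev_map o_def)
qed

lemma order_isomorphic_rev_complement: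
  assumes "order_isomorphic s q" "set s \<subseteq> {1..n}" "set q \<subseteq> {1..m}"
  shows "order_isomorphic (rev_complement n s) (rev_complement m q)"
  using assms by (auto simp: order_isomorphic_def rev_complement_nth_less_iff)

lemma subseq_rev: "subseq xs ys \<Longrightarrow> subseq (rev xs) (rev ys)"
  by (induction rule: list_emb.induct) (auto intro: list_emb_append_mono subseq_rev_drop_many)

lemma avoids_rev_complement_imp:
  assumes "avoids (rev_complement n p) (rev_complement m q)" "set p \<subseteq> {1..n}" "set q \<subseteq> {1..m}"
  shows "avoids p q"
  unfolding avoids_def
proof
  assume "\<exists>s. subseq s p \<and> order_isomorphic s q"
  then obtain s where s: "subseq s p" "order_isomorphic s q" by blast
  have "subseq (rev_complement n s) (rev_complement n p)"
    unfolding rev_complement_def by (intro subseq_rev subseq_map s(1))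
  moreover have "set s \<subseteq> {1..n}"
    using s(1) assms(2) by (auto simp: subseq_conv_nths dest: in_set_nthsD)
  then have "order_isomorphic (rev_complement n s) (rev_complement m q)"
    using s(2) assms(3) by (intro order_isomorphic_rev_complement)
  ultimately show False using assms(1) unfolding avoids_def by blast
qed

text \<open>The one-sided version, applied to the images, yields the converse, because the reverse
  complement is an involution.\<close>

lemma avoids_rev_complement:
  assumes "set p \<subseteq> {1..n}" "set q \<subseteq> {1..m}"
  shows "avoids (rev_complement n p) (rev_complement m q) \<longleftrightarrow> avoids p q"
  using avoids_rev_complement_imp[of n p m q] avoids_rev_complement_imp[of n "rev_complement n p" m "rev_complement m q"]
    set_rev_complement[OF assms(1)] set_rev_complement[OF assms(2)] assms
  by (auto simp: rev_complement_involution)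

text \<open>Reversal and complement each exchange inversions and non-inversions, so their
  composition preserves them up to mirroring the positions.\<close>

lemma inversions_rev_complement:
  assumes "set p \<subseteq> {1..n}"
  shows "inversions (rev_complement n p) = inversions p"
proof -
  let ?f = "\<lambda>(i, j). (length p - Suc j, length p - Suc i)"
  have "bij_betw ?f
      {(i, j). i < j \<and> j < length (rev_complement n p) \<and> rev_complement n p ! i > rev_complement n p ! j}
      {(i, j). i < j \<and> j < length p \<and> p ! i > p ! j}"
    using assms by (intro bij_betw_byWitness[where f' = ?f]) (auto simp: rev_complement_nth_less_iff)
  then show ?thesis unfolding inversions_def by (rule bij_betw_same_card)
qed

lemma rev_complement_permutations:
  assumes "p \<in> permutations_of_set {1..n}"
  shows "rev_complement n p \<in> permutations_of_set {1..n}"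
proof (rule permutations_of_setI)
  from assms have p: "set p = {1..n}" "distinct p" by (auto dest: permutations_of_setD)
  have inj: "inj_on (\<lambda>x. Suc n - x) {1..n}" by (auto simp: inj_on_def)
  then show "distinct (rev_complement n p)"
    using p by (simp add: rev_complement_def distinct_map)
  have "(\<lambda>x. Suc n - x) ` {1..n} = {1..n}"
    using inj by (intro card_subset_eq) (auto simp: card_image)
  then show "set (rev_complement n p) = {1..n}"
    using p by (simp add: rev_complement_def)
qed

definition avoiders :: "nat list set \<Rightarrow> nat \<Rightarrow> nat list set" where
  "avoiders B n = {p \<in> permutations_of_set {1..n}. \<forall>q\<in>B. avoids p q}"

lemma finite_avoiders [simp]: "finite (avoiders B n)"
  by (simp add: avoiders_def)

text \<open>The reverse complement fixes 4231 and exchanges 132 and 213, so both factors of the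
  square come from one count.\<close>

lemma weight_enum_avoiders_rev_complement:
  "weight_enum inversions (avoiders {[2, 1, 3], [4, 2, 3, 1]} n) =
    weight_enum inversions (avoiders {[1, 3, 2], [4, 2, 3, 1]} n)"
proof -
  have sub: "set p \<subseteq> {1..n}" if "p \<in> permutations_of_set {1..n}" for p
    using that by (auto dest: permutations_of_setD)
  have rc: "rev_complement 3 [1, 3, 2] = [2, 1, 3]" "rev_complement 3 [2, 1, 3] = [1, 3, 2]"
    "rev_complement 4 [4, 2, 3, 1] = [4, 2, 3, 1]"
    by (simp_all add: rev_complement_def)
  have 132: "avoids (rev_complement n p) [2, 1, 3] \<longleftrightarrow> avoids p [1, 3, 2]"
    and 213: "avoids (rev_complement n p) [1, 3, 2] \<longleftrightarrow> avoids p [2, 1, 3]"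
    and 4231: "avoids (rev_complement n p) [4, 2, 3, 1] \<longleftrightarrow> avoids p [4, 2, 3, 1]"
    if "p \<in> permutations_of_set {1..n}" for p
    using avoids_rev_complement[OF sub[OF that], of "[1, 3, 2]" 3]
      avoids_rev_complement[OF sub[OF that], of "[2, 1, 3]" 3]
      avoids_rev_complement[OF sub[OF that], of "[4, 2, 3, 1]" 4]
    unfolding rc by simp_all
  have "bij_betw (rev_complement n) (avoiders {[1, 3, 2], [4, 2, 3, 1]} n)
      (avoiders {[2, 1, 3], [4, 2, 3, 1]} n)"
    by (rule bij_betw_byWitness[where f' = "rev_complement n"])
      (auto simp: avoiders_def 132 213 4231 rev_complement_permutations rev_complement_involution[OF sub]
        simp del: One_nat_def)
  then have "weight_enum inversions (avoiders {[2, 1, 3], [4, 2, 3, 1]} n) =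
      fps_X ^ 0 * weight_enum inversions (avoiders {[1, 3, 2], [4, 2, 3, 1]} n)"
    by (rule weight_enum_bij_betw) (auto simp: avoiders_def inversions_rev_complement[OF sub])
  then show ?thesis by simp
qed

text \<open>Equal zeros do not count as a repeat, so a final run of zeros imposes no bound on the
  drop in front of it.\<close>

lemma good_code_append_zeros:
  "good_code (c @ replicate m 0) \<longleftrightarrow> good_code c" "has_repeat (c @ replicate m 0) \<longleftrightarrow> has_repeat c"
proof -
  have zeros: "good_code (replicate m 0) \<and> \<not> has_repeat (replicate m 0)" for m
  proof (induction m)
    case (Suc m)
    then show ?case by (cases m) auto
  qed simp
  have "(good_code (c @ replicate m 0) \<longleftrightarrow> good_code c) \<and> (has_repeat (c @ replicate m 0) \<longleftrightarrow> has_repeat c)"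
  proof (induction c rule: induct_list012)
    case (2 x)
    show ?case using zeros[of m] by (cases m) auto
  qed (use zeros in auto)
  then show "good_code (c @ replicate m 0) \<longleftrightarrow> good_code c"
    "has_repeat (c @ replicate m 0) \<longleftrightarrow> has_repeat c" by auto
qed

text \<open>A good code decreases weakly, so its zeros all stand at the end.\<close>

lemma good_code_filter_nonzero:
  "good_code c \<Longrightarrow> filter (\<lambda>x. x \<noteq> 0) c @ replicate (length c - length (filter (\<lambda>x. x \<noteq> 0) c)) 0 = c"
proof (induction c rule: induct_list012)
  case (3 x y c)
  have le: "length (filter (\<lambda>x. x \<noteq> 0) c) \<le> length c" by simp
  from 3 have IH: "filter (\<lambda>x. x \<noteq> 0) (y # c) @
      replicate (length (y # c) - length (filter (\<lambda>x. x \<noteq> 0) (y # c))) 0 = y # c" by simp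
  show ?case
  proof (cases "x = 0")
    case True
    then have "y = 0" using 3 by simp
    with IH le have "filter (\<lambda>x. x \<noteq> 0) c = []" by (cases "filter (\<lambda>x. x \<noteq> 0) c") (auto dest: filter_eq_ConsD)
    with IH True \<open>y = 0\<close> show ?thesis by simp
  next
    case False
    with IH show ?thesis by (simp split: if_splits)
  qed
qed auto

text \<open>The \<open>i\<close> entries before a nonzero entry are at least as large, hence each at
  least 1. The bound by \<open>hd c\<close> carries the induction: it shows that a newly prepended
  entry is positive.\<close>

lemma good_code_nth_le_sum_list:
  "good_code c \<Longrightarrow> i < length c \<Longrightarrow> c ! i \<noteq> 0 \<Longrightarrow> c ! i \<le> hd c \<and> c ! i + i \<le> sum_list c"
proof (induction c arbitrary: i rule: induct_list012)
  case (3 x y c)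
  show ?case
  proof (cases i)
    case (Suc j)
    then have "(y # c) ! j \<noteq> 0" "y \<le> x" using "3.prems" by auto
    moreover have "(y # c) ! j \<le> y \<and> (y # c) ! j + j \<le> sum_list (y # c)"
      using "3.IH"(2)[of j] "3.prems" Suc by auto
    ultimately show ?thesis using Suc by auto
  qed simp
qed auto

text \<open>A good code with entry sum \<open>k < n\<close> automatically satisfies the bounds \<open>c ! i + i < n\<close> on Lehmer
  codes, so only the number of trailing zeros depends on \<open>n\<close>.\<close>

lemma weight_enum_avoiders_132:
  assumes "k < n"
  shows "fps_nth (weight_enum inversions (avoiders {[1, 3, 2], [4, 2, 3, 1]} n)) k =
    fps_nth (weight_enum sum_list good_parts) k"
proof -
  let ?A = "{p \<in> avoiders {[1, 3, 2], [4, 2, 3, 1]} n. inversions p = k}"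
  let ?C = "{c. length c = n \<and> good_code c \<and> sum_list c = k}"
  let ?G = "{c \<in> good_parts. sum_list c = k}"
  have bij: "bij_betw lehmer (permutations_of_set {1..n}) {c. length c = n \<and> (\<forall>i<n. c ! i + i < n)}"
    using bij_betw_lehmer[of "{1..n}"] by simp
  have A: "?A = {p \<in> permutations_of_set {1..n}. good_code (lehmer p) \<and> sum_list (lehmer p) = k}"
    by (auto simp: avoiders_def good_code_lehmer inversions_eq_sum_list_lehmer
        dest: permutations_of_setD simp del: One_nat_def)
  have C: "c ! i + i < n" if "c \<in> ?C" "i < n" for c i
    using good_code_nth_le_sum_list[of c i] that assms by (cases "c ! i = 0") auto
  have "lehmer ` ?A = {c \<in> lehmer ` permutations_of_set {1..n}. good_code c \<and> sum_list c = k}"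
    unfolding A by blast
  also have "\<dots> = ?C"
    unfolding bij_betw_imp_surj_on[OF bij] using C by blast
  finally have img: "lehmer ` ?A = ?C" .
  have "inj_on lehmer ?A"
    by (rule inj_on_subset[OF bij_betw_imp_inj_on[OF bij]]) (auto simp: avoiders_def)
  then have "card ?A = card ?C"
    unfolding img[symmetric] by (rule card_image[symmetric])
  \<comment> \<open>A partition of \<open>k\<close> has at most \<open>k < n\<close> parts, so
    padding with zeros always reaches length \<open>n\<close>.\<close>
  moreover have "bij_betw (\<lambda>c. c @ replicate (n - length c) 0) ?G ?C"
  proof (rule bij_betw_byWitness[where f' = "filter (\<lambda>x. x \<noteq> 0)"])
    show "\<forall>c\<in>?G. filter (\<lambda>x. x \<noteq> 0) (c @ replicate (n - length c) 0) = c"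
      by (auto simp: good_parts_def filter_id_conv intro!: gr0I)
    show "\<forall>c\<in>?C. filter (\<lambda>x. x \<noteq> 0) c @ replicate (n - length (filter (\<lambda>x. x \<noteq> 0) c)) 0 = c"
      using good_code_filter_nonzero by auto
    show "(\<lambda>c. c @ replicate (n - length c) 0) ` ?G \<subseteq> ?C"
      using assms by (auto simp: good_parts_def good_code_append_zeros sum_list_replicate dest: length_le_sum_list)
    show "filter (\<lambda>x. x \<noteq> 0) ` ?C \<subseteq> ?G"
    proof clarify
      fix c :: "nat list" assume c: "good_code c" "n = length c" "k = sum_list c"
      have "good_code (filter (\<lambda>x. x \<noteq> 0) c)"
        using good_code_filter_nonzero[OF c(1)] c(1) good_code_append_zeros(1) by metis
      moreover have "sum_list (filter (\<lambda>x. x \<noteq> 0) c) = sum_list c" by (induction c) auto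
      ultimately show "filter (\<lambda>x. x \<noteq> 0) c \<in> good_parts \<and> sum_list (filter (\<lambda>x. x \<noteq> 0) c) = sum_list c"
        by (simp add: good_parts_def)
    qed
  qed
  then have "card ?G = card ?C" by (rule bij_betw_same_card)
  ultimately show ?thesis by simp
qed

section \<open>Splitting at a central entry\<close>

text \<open>The first entry of a 4231 exceeds its last, so an occurrence cannot begin in
  \<open>xs\<close> and end in \<open>ys\<close>.\<close>

lemma avoids_4231_append:
  assumes "\<And>x y. x \<in> set xs \<Longrightarrow> y \<in> set ys \<Longrightarrow> x < y"
  shows "avoids (xs @ ys) [4, 2, 3, 1] \<longleftrightarrow> avoids xs [4, 2, 3, 1] \<and> avoids ys [4, 2, 3, 1]"
proof
  assume "avoids (xs @ ys) [4, 2, 3, 1]"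
  then show "avoids xs [4, 2, 3, 1] \<and> avoids ys [4, 2, 3, 1]"
    unfolding avoids_def by (meson subseq_drop_many subseq_rev_drop_many)
next
  assume R: "avoids xs [4, 2, 3, 1] \<and> avoids ys [4, 2, 3, 1]"
  show "avoids (xs @ ys) [4, 2, 3, 1]"
    unfolding avoids_4231
  proof (intro allI impI notI)
    fix a b c d assume sub: "subseq [a, b, c, d] (xs @ ys)" and less: "d < b" "b < c" "c < a"
    from sub obtain u w where uw: "[a, b, c, d] = u @ w" "subseq u xs" "subseq w ys"
      by (rule subseq_appendE)
    have "u = [] \<or> w = []"
    proof (rule ccontr)
      assume nonempty: "\<not> (u = [] \<or> w = [])"
      then have "a = hd u" "d = last w"
        using uw(1) by (metis hd_append2 list.sel(1), metis last.simps last_appendR list.distinct(1))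
      then have "a \<in> set u" "d \<in> set w" using nonempty by auto
      then have "a < d" using assms uw(2,3) list_emb_set by (metis (full_types))
      then show False using less by simp
    qed
    then have "subseq [a, b, c, d] xs \<or> subseq [a, b, c, d] ys" using uw by auto
    then show False using R less unfolding avoids_4231 by blast
  qed
qed

lemma subseq_set: "subseq s xs \<Longrightarrow> set s \<subseteq> set xs"
  by (auto elim: list_emb_set)

text \<open>\<open>v\<close> serves as the 4 above a 132 on its left and as the 1 below a 213 on its
  right. Conversely, the 3 and the 2 of a 1324 cannot lie on different sides of the cut before
  \<open>v\<close>, so either its 132 lies in \<open>xs\<close> or its 324 lies in
  \<open>v # ys\<close>; in the latter case \<open>v\<close> is too small to be the 3.\<close>

lemma avoids_1324_append:
  assumes "\<And>x. x \<in> set xs \<Longrightarrow> x < v" "\<And>y. y \<in> set ys \<Longrightarrow> v < y"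
  shows "avoids (xs @ v # ys) [1, 3, 2, 4] \<longleftrightarrow> avoids xs [1, 3, 2] \<and> avoids ys [2, 1, 3]"
proof
  assume L: "avoids (xs @ v # ys) [1, 3, 2, 4]"
  have "avoids xs [1, 3, 2]"
    unfolding avoids_132
  proof (intro allI impI notI)
    fix a b c assume sub: "subseq [a, b, c] xs" and less: "a < c" "c < b"
    have "subseq ([a, b, c] @ [v]) (xs @ v # ys)"
      by (intro list_emb_append_mono sub) simp
    moreover have "b < v" using subseq_set[OF sub] assms(1) by auto
    ultimately show False using L less unfolding avoids_1324 by auto
  qed
  moreover have "avoids ys [2, 1, 3]"
    unfolding avoids_213
  proof (intro allI impI notI)
    fix a b c assume sub: "subseq [a, b, c] ys" and less: "b < a" "a < c"
    have "subseq [v, a, b, c] (xs @ v # ys)"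
      by (intro subseq_drop_many) (simp add: sub)
    moreover have "v < b" using subseq_set[OF sub] assms(2) by auto
    ultimately show False using L less unfolding avoids_1324 by auto
  qed
  ultimately show "avoids xs [1, 3, 2] \<and> avoids ys [2, 1, 3]" ..
next
  assume R: "avoids xs [1, 3, 2] \<and> avoids ys [2, 1, 3]"
  show "avoids (xs @ v # ys) [1, 3, 2, 4]"
    unfolding avoids_1324
  proof (intro allI impI notI)
    fix a b c d assume sub: "subseq [a, b, c, d] (xs @ v # ys)" and less: "a < c" "c < b" "b < d"
    have right: "\<not> subseq [b, c, d] ys"
      using R less unfolding avoids_213 by blast
    have right': "\<not> subseq [b, c, d] (v # ys)"
    proof
      assume "subseq [b, c, d] (v # ys)"
      with right have "b = v" "subseq [c, d] ys" by auto
      then show False using subseq_set[of "[c, d]" ys] assms(2)[of c] less by auto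
    qed
    have left: "\<not> subseq [a, b, c] xs"
      using R less unfolding avoids_132 by blast
    have left': "\<not> (b \<in> set xs \<and> c \<in> set (v # ys))"
      using assms less by fastforce
    from sub obtain s t where st: "[a, b, c, d] = s @ t" "subseq s xs" "subseq t (v # ys)"
      by (rule subseq_appendE)
    \<comment> \<open>The part \<open>s\<close> of the occurrence inside \<open>xs\<close> has
      length 0, 1, 2 or at least 3; length 2 would separate the 3 from the 2.\<close>
    have "s = [] \<or> (\<exists>x. s = [x]) \<or> (\<exists>x y. s = [x, y]) \<or> (\<exists>x y z u. s = x # y # z # u)"
      by (metis list.exhaust)
    with st(1) have "t = [b, c, d] \<or> t = [a, b, c, d] \<or> s = [a, b] \<and> t = [c, d] \<or> (\<exists>u. s = a # b # c # u)"
      by (elim disjE exE) simp_all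
    then consider "t = [b, c, d]" | "t = [a, b, c, d]" | "s = [a, b]" "t = [c, d]" | u where "s = a # b # c # u"
      by blast
    then show False
    proof cases
      case 1
      show False using st(3) right' unfolding 1 by blast
    next
      case 2
      have "subseq [b, c, d] (v # ys)" using st(3) unfolding 2 by (rule subseq_Cons')
      then show False using right' by blast
    next
      case 3
      show False using subseq_set[OF st(2)] subseq_set[OF st(3)] left' unfolding 3 by auto
    next
      case 4
      have "subseq [a, b, c] (a # b # c # u)" by simp
      then show False using 4 st(2) left by (meson subseq_order.order_trans)
    qed
  qed
qed

section \<open>A central entry without inversions\<close>

lemma subseq_nth_Cons_drop:
  assumes "subseq ys (drop j xs)" "i < j" "i < length xs"
  shows "subseq (xs ! i # ys) (drop i xs)"
proof -
  have "drop j xs = drop (j - Suc i) (drop (Suc i) xs)" using assms by simp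
  then have "subseq ys (drop (Suc i) xs)"
    using assms(1) by (metis append_take_drop_id subseq_drop_many)
  then show ?thesis using assms(3) by (simp add: Cons_nth_drop_Suc[symmetric] del: drop_Suc)
qed

lemma subseq_nth4:
  assumes "i < j" "j < k" "k < l" "l < length xs"
  shows "subseq [xs ! i, xs ! j, xs ! k, xs ! l] xs"
proof -
  have "subseq [xs ! l] (drop l xs)" using assms subseq_nth_Cons_drop[of "[]" "Suc l" xs l] by simp
  then have "subseq [xs ! k, xs ! l] (drop k xs)" using assms by (intro subseq_nth_Cons_drop) auto
  then have "subseq [xs ! j, xs ! k, xs ! l] (drop j xs)" using assms by (intro subseq_nth_Cons_drop) auto
  then have "subseq [xs ! i, xs ! j, xs ! k, xs ! l] (drop i xs)"
    using assms by (intro subseq_nth_Cons_drop) auto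
  then show ?thesis by (metis append_take_drop_id subseq_drop_many)
qed

text \<open>Each inversion involves two positions, so some position in \<open>X\<close> takes part
  in none.\<close>

lemma obtain_uninvolved_index:
  assumes "finite X" "2 * inversions p < card X" "X \<subseteq> {..<length p}" "distinct p"
  obtains q where "q \<in> X" "\<And>i. i < q \<Longrightarrow> p ! i < p ! q"
    "\<And>i. q < i \<Longrightarrow> i < length p \<Longrightarrow> p ! q < p ! i"
proof -
  define I where "I = {(i, j). i < j \<and> j < length p \<and> p ! i > p ! j}"
  have fin: "finite I"
    by (rule finite_subset[of _ "{..<length p} \<times> {..<length p}"]) (auto simp: I_def)
  have "card (fst ` I \<union> snd ` I) \<le> card (fst ` I) + card (snd ` I)" by (rule card_Un_le)
  also have "\<dots> \<le> card I + card I" by (intro add_mono card_image_le fin)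
  also have "\<dots> < card X" using assms(2) by (simp add: I_def inversions_def)
  finally have "\<not> X \<subseteq> fst ` I \<union> snd ` I"
    using fin card_mono[of "fst ` I \<union> snd ` I" X] by auto
  then obtain q where q: "q \<in> X" "q \<notin> fst ` I" "q \<notin> snd ` I" by blast
  have "q < length p" using q assms(3) by auto
  show thesis
  proof (rule that[OF q(1)])
    fix i assume "i < q"
    moreover from this have "\<not> p ! i > p ! q"
      using q(3) \<open>q < length p\<close> by (force simp: I_def image_iff)
    moreover have "p ! i \<noteq> p ! q"
      using \<open>i < q\<close> \<open>q < length p\<close> assms(4) by (simp add: nth_eq_iff_index_eq)
    ultimately show "p ! i < p ! q" by simp
  next
    fix i assume i: "q < i" "i < length p"
    then have "\<not> p ! q > p ! i"
      using q(2) by (force simp: I_def image_iff)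
    moreover have "p ! i \<noteq> p ! q"
      using i assms(4) by (simp add: nth_eq_iff_index_eq)
    ultimately show "p ! q < p ! i" by simp
  qed
qed

text \<open>Take uninvolved positions \<open>q\<close> before and \<open>r\<close> after
  \<open>m\<close>. If \<open>m\<close> and \<open>t\<close> were inverted, \<open>t\<close> would
  lie between \<open>q\<close> and \<open>r\<close> as well, and the inverted pair would be the 32
  of a 1324 with its 1 at \<open>q\<close> and its 4 at \<open>r\<close>.\<close>

lemma avoids_1324_middle_not_inverted:
  assumes "distinct p" "avoids p [1, 3, 2, 4]" "4 * inversions p + 3 \<le> length p"
    and m: "m = Suc (2 * inversions p)" and t: "t < length p"
  shows "(t < m \<longrightarrow> p ! t < p ! m) \<and> (m < t \<longrightarrow> p ! m < p ! t)"
proof -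
  \<comment> \<open>The choice of \<open>m\<close> and the bound on the length leave at least
    \<open>2 * inversions p + 1\<close> positions on either side of \<open>m\<close>.\<close>
  obtain q where q: "q \<in> {..<m}" "\<And>i. i < q \<Longrightarrow> p ! i < p ! q"
      "\<And>i. q < i \<Longrightarrow> i < length p \<Longrightarrow> p ! q < p ! i"
  proof (rule obtain_uninvolved_index[of "{..<m}" p])
    show "{..<m} \<subseteq> {..<length p}" using assms by auto
  qed (use assms in simp_all)
  obtain r where r: "r \<in> {Suc m..<length p}" "\<And>i. i < r \<Longrightarrow> p ! i < p ! r"
      "\<And>i. r < i \<Longrightarrow> i < length p \<Longrightarrow> p ! r < p ! i"
  proof (rule obtain_uninvolved_index[of "{Suc m..<length p}" p])
    show "2 * inversions p < card {Suc m..<length p}" using assms by simp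
  qed (use assms in auto)
  have no1324: "\<not> (p ! i < p ! k \<and> p ! k < p ! j \<and> p ! j < p ! l)"
    if "i < j" "j < k" "k < l" "l < length p" for i j k l
    using subseq_nth4[OF that] assms(2) unfolding avoids_1324 by blast
  have ne: "p ! t \<noteq> p ! m" if "t \<noteq> m"
    using that assms by (simp add: nth_eq_iff_index_eq)
  show ?thesis
  proof (intro conjI impI; rule ccontr)
    assume "t < m" "\<not> p ! t < p ! m"
    then have inv: "p ! m < p ! t" using ne by simp
    have "p ! q < p ! m" "p ! t < p ! r" using q(1) q(3)[of m] r(1) r(2)[of t] \<open>t < m\<close> by auto
    \<comment> \<open>With \<open>t\<close> at or before \<open>q\<close>, the entry at
      \<open>t\<close> would be at most that at \<open>q\<close> and hence below that at
      \<open>m\<close>.\<close>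
    moreover have "q < t"
      using q(2)[of t] q(1) \<open>p ! q < p ! m\<close> inv by (cases q t rule: linorder_cases) auto
    ultimately show False using no1324[of q t m r] q r inv \<open>t < m\<close> by auto
  next
    assume "m < t" "\<not> p ! m < p ! t"
    then have inv: "p ! t < p ! m" using ne by simp
    have "p ! q < p ! t" "p ! m < p ! r" using q(1) q(3)[of t] r(1) r(2)[of m] \<open>m < t\<close> t by auto
    moreover have "t < r"
      using r(3)[of t] r(1) t \<open>p ! m < p ! r\<close> inv by (cases r t rule: linorder_cases) auto
    ultimately show False using no1324[of q m t r] q r inv \<open>m < t\<close> by auto
  qed
qed

section \<open>Direct sums with a middle entry\<close>

definition glue :: "nat \<Rightarrow> nat list \<times> nat list \<Rightarrow> nat list" where
  "glue m = (\<lambda>(p, q). p @ Suc m # map (\<lambda>x. x + Suc m) q)"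

lemma strict_mono_add_nat: "strict_mono (\<lambda>x. x + n :: nat)"
  by (simp add: strict_mono_def)

text \<open>The glued list is the direct sum \<alpha> \<oplus> 1 \<oplus> \<beta>. No inversion
  crosses its blocks, so the Lehmer codes are concatenated, with a 0 for the middle entry.\<close>

lemma glue_properties:
  assumes p: "p \<in> permutations_of_set {1..m}" and q: "q \<in> permutations_of_set {1..l}"
  shows glue_permutation: "glue m (p, q) \<in> permutations_of_set {1..Suc m + l}"
    and inversions_glue: "inversions (glue m (p, q)) = inversions p + inversions q"
    and glue_avoids_1324: "avoids (glue m (p, q)) [1, 3, 2, 4] \<longleftrightarrow> avoids p [1, 3, 2] \<and> avoids q [2, 1, 3]"
    and glue_avoids_4231: "avoids (glue m (p, q)) [4, 2, 3, 1] \<longleftrightarrow>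
      avoids p [4, 2, 3, 1] \<and> avoids q [4, 2, 3, 1]"
proof -
  let ?q = "map (\<lambda>x. x + Suc m) q"
  have glue: "glue m (p, q) = p @ Suc m # ?q" by (simp add: glue_def)
  have p': "set p = {1..m}" "distinct p" and q': "set q = {1..l}" "distinct q"
    using p q by (auto dest: permutations_of_setD)
  have set_q: "set ?q = {Suc m + 1..Suc m + l}"
  proof -
    have "set ?q = (\<lambda>x. x + Suc m) ` {1..l}" by (simp add: q')
    also have "\<dots> = {1 + Suc m..l + Suc m}" by (rule image_add_atLeastAtMost')
    finally show ?thesis by (simp add: add.commute)
  qed
  have less1: "x < Suc m" if "x \<in> set p" for x using that p' by auto
  have less2: "Suc m < y" if "y \<in> set ?q" for y using that unfolding set_q by simp
  have distinct_q: "distinct ?q" using q' by (simp add: distinct_map inj_on_def)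
  show perm: "glue m (p, q) \<in> permutations_of_set {1..Suc m + l}"
  proof (rule permutations_of_setI)
    show "set (glue m (p, q)) = {1..Suc m + l}"
      unfolding glue set_append list.set set_q p' by auto
    show "distinct (glue m (p, q))"
      unfolding glue using p' distinct_q less1 less2 by fastforce
  qed
  have q_mono: "lehmer ?q = lehmer q"
    by (rule lehmer_map_strict_mono[OF strict_mono_add_nat])
  have "{y \<in> set ?q. y < Suc m} = {}" using less2 by (blast dest: less_asym)
  then have "lehmer (Suc m # ?q) = 0 # lehmer q"
    unfolding lehmer.simps q_mono by (simp only: card.empty)
  moreover have "lehmer (p @ Suc m # ?q) = lehmer p @ lehmer (Suc m # ?q)"
    using less1 less2 by (intro lehmer_append_less) fastforce
  ultimately have "lehmer (glue m (p, q)) = lehmer p @ 0 # lehmer q"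
    unfolding glue by simp
  then show "inversions (glue m (p, q)) = inversions p + inversions q"
    using p' q' permutations_of_setD(2)[OF perm] by (simp add: inversions_eq_sum_list_lehmer)
  show "avoids (glue m (p, q)) [1, 3, 2, 4] \<longleftrightarrow> avoids p [1, 3, 2] \<and> avoids q [2, 1, 3]"
    unfolding glue avoids_map_strict_mono[OF strict_mono_add_nat, of "Suc m" q, symmetric]
    by (rule avoids_1324_append[OF less1 less2])
  have "avoids (Suc m # ?q) [4, 2, 3, 1] \<longleftrightarrow> avoids ?q [4, 2, 3, 1]"
  proof -
    have "avoids [Suc m] [4, 2, 3, 1]" by (simp add: avoids_short)
    moreover have "avoids ([Suc m] @ ?q) [4, 2, 3, 1] \<longleftrightarrow>
        avoids [Suc m] [4, 2, 3, 1] \<and> avoids ?q [4, 2, 3, 1]"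
      by (rule avoids_4231_append) (use less2 in auto)
    ultimately show ?thesis by simp
  qed
  moreover have "avoids (p @ Suc m # ?q) [4, 2, 3, 1] \<longleftrightarrow>
      avoids p [4, 2, 3, 1] \<and> avoids (Suc m # ?q) [4, 2, 3, 1]"
    using less1 less2 by (intro avoids_4231_append) fastforce
  ultimately show "avoids (glue m (p, q)) [4, 2, 3, 1] \<longleftrightarrow> avoids p [4, 2, 3, 1] \<and> avoids q [4, 2, 3, 1]"
    unfolding glue by (simp only: avoids_map_strict_mono[OF strict_mono_add_nat])
qed

text \<open>The entry at position \<open>m\<close> exceeds everything before it and is below
  everything after it. So the \<open>m\<close> entries before it are all the smaller values, and it
  equals \<open>Suc m\<close>. The assumption \<open>m \<le> l\<close> makes the length at least
  \<open>4 * inversions p + 3\<close>.\<close>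

lemma glue_surj:
  assumes p: "p \<in> permutations_of_set {1..Suc m + l}" "avoids p [1, 3, 2, 4]"
    and k: "m = Suc (2 * inversions p)" "m \<le> l"
  obtains s t where "s \<in> permutations_of_set {1..m}" "t \<in> permutations_of_set {1..l}" "p = glue m (s, t)"
proof -
  let ?s = "take m p" and ?v = "p ! m" and ?u = "drop (Suc m) p"
  have set_p: "set p = {1..Suc m + l}" and dist: "distinct p"
    using p by (auto dest: permutations_of_setD)
  then have len: "length p = Suc m + l" using distinct_card[OF dist] by simp
  have split: "p = ?s @ ?v # ?u" using len by (simp add: id_take_nth_drop)
  have mid: "(t < m \<longrightarrow> p ! t < p ! m) \<and> (m < t \<longrightarrow> p ! m < p ! t)" if "t < length p" for t
    using avoids_1324_middle_not_inverted[OF dist p(2) _ k(1) that] k len by simp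
  have less1: "x < ?v" if "x \<in> set ?s" for x
    using that mid len by (auto simp: in_set_conv_nth)
  have less2: "?v < y" if "y \<in> set ?u" for y
    using that mid len by (auto simp: in_set_conv_nth)
  have union: "{1..Suc m + l} = set ?s \<union> insert ?v (set ?u)"
    using arg_cong[OF split, of set] by (simp add: set_p)
  have v: "?v \<in> {1..Suc m + l}" using union by blast
  have s_eq: "set ?s = {1..<?v}"
  proof (intro equalityI subsetI)
    fix x assume "x \<in> set ?s"
    then show "x \<in> {1..<?v}" using less1 union by fastforce
  next
    fix x assume x: "x \<in> {1..<?v}"
    then have "x \<in> set ?s \<union> insert ?v (set ?u)" using v unfolding union[symmetric] by simp
    then show "x \<in> set ?s" using x less2 by fastforce
  qed
  have "card (set ?s) = m" using dist len by (simp add: distinct_card)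
  then have v_eq: "?v = Suc m" using v unfolding s_eq card_atLeastLessThan atLeastAtMost_iff by linarith
  have u_eq: "set ?u = {Suc m + 1..Suc m + l}"
  proof (intro equalityI subsetI)
    fix x assume "x \<in> set ?u"
    then show "x \<in> {Suc m + 1..Suc m + l}" using less2 union v_eq by fastforce
  next
    fix x assume x: "x \<in> {Suc m + 1..Suc m + l}"
    then have "x \<in> set ?s \<union> insert ?v (set ?u)" unfolding union[symmetric] by simp
    then show "x \<in> set ?u" using x less1 v_eq by fastforce
  qed
  \<comment> \<open>The truncated subtraction is exact, because all entries of \<open>?u\<close>
    exceed \<open>Suc m\<close>.\<close>
  define t where "t = map (\<lambda>x. x - Suc m) ?u"
  have "map (\<lambda>x. x + Suc m) t = ?u"
    unfolding t_def map_map using u_eq by (intro map_idI) auto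
  then have "?s @ Suc m # ?u = glue m (?s, t)"
    by (simp only: glue_def prod.case)
  with split[unfolded v_eq] have "p = glue m (?s, t)"
    by (rule trans)
  moreover have "?s \<in> permutations_of_set {1..m}"
  proof (rule permutations_of_setI)
    show "set ?s = {1..m}" unfolding s_eq v_eq by auto
    show "distinct ?s" using dist by simp
  qed
  moreover have "t \<in> permutations_of_set {1..l}"
  proof (rule permutations_of_setI)
    have "set t = (\<lambda>x. x - Suc m) ` (\<lambda>x. x + Suc m) ` {1..l}"
      unfolding t_def set_map u_eq image_add_atLeastAtMost' by (simp add: add.commute)
    then show "set t = {1..l}" by (simp add: image_image)
    have "inj_on (\<lambda>x. x - Suc m) (set ?u)" unfolding u_eq by (auto simp: inj_on_def)
    then show "distinct t" unfolding t_def using dist by (simp add: distinct_map)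
  qed
  ultimately show thesis using that by blast
qed

text \<open>The cut position \<open>m\<close> depends only on \<open>k\<close>, so the splitting is
  unique and \<open>glue m\<close> is a bijection onto the permutations counted. Inversions add up,
  which gives a Cauchy product.\<close>

lemma av_eq_fps_nth:
  assumes "4 * k + 3 \<le> n"
  shows "int (av {[1, 3, 2, 4], [4, 2, 3, 1]} n k) = fps_nth (weight_enum sum_list good_parts ^ 2) k"
proof -
  define m where "m = Suc (2 * k)"
  define l where "l = n - Suc m"
  have n: "n = Suc m + l" and ml: "m \<le> l" using assms by (auto simp: m_def l_def)
  let ?A = "avoiders {[1, 3, 2], [4, 2, 3, 1]} m" and ?B = "avoiders {[2, 1, 3], [4, 2, 3, 1]} l"
  let ?S = "{x \<in> ?A \<times> ?B. (case x of (p, q) \<Rightarrow> inversions p + inversions q) = k}"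
  let ?T = "{p \<in> permutations_of_set {1..n}. inversions p = k \<and> (\<forall>q\<in>{[1, 3, 2, 4], [4, 2, 3, 1]}. avoids p q)}"
  have avoiders: "p \<in> permutations_of_set {1..m}" "q \<in> permutations_of_set {1..l}" if "(p, q) \<in> ?A \<times> ?B" for p q
    using that by (auto simp: avoiders_def)
  have "inj_on (glue m) (?A \<times> ?B)"
  proof (rule inj_onI, clarify)
    fix p q p' q' assume "glue m (p, q) = glue m (p', q')" "p \<in> ?A" "p' \<in> ?A"
    moreover have "length p = m" if "p \<in> ?A" for p
      using that length_finite_permutations_of_set[of p "{1..m}"] by (simp add: avoiders_def)
    ultimately have "p = p' \<and> map (\<lambda>x. x + Suc m) q = map (\<lambda>x. x + Suc m) q'"
      by (auto simp: glue_def)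
    then show "p = p' \<and> q = q'" by (simp add: inj_map_eq_map inj_def)
  qed
  then have inj: "inj_on (glue m) ?S" by (rule inj_on_subset) auto
  have img: "glue m ` ?S = ?T"
  proof (intro equalityI subsetI)
    fix r assume "r \<in> glue m ` ?S"
    then obtain p q where pq: "r = glue m (p, q)" "p \<in> ?A" "q \<in> ?B" "inversions p + inversions q = k" by auto
    then have perms: "p \<in> permutations_of_set {1..m}" "q \<in> permutations_of_set {1..l}"
      by (auto simp: avoiders_def)
    then show "r \<in> ?T"
      using glue_properties[OF perms] pq by (simp add: avoiders_def n)
  next
    fix r assume r: "r \<in> ?T"
    then obtain s t where st: "s \<in> permutations_of_set {1..m}" "t \<in> permutations_of_set {1..l}" "r = glue m (s, t)"
      using glue_surj[of r m l] ml by (auto simp: n m_def)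
    then have "(s, t) \<in> ?S"
      using glue_properties[OF st(1,2)] r by (simp add: avoiders_def)
    then show "r \<in> glue m ` ?S" using st(3) by blast
  qed
  have "card ?T = card ?S" unfolding img[symmetric] by (rule card_image[OF inj])
  then have "int (av {[1, 3, 2, 4], [4, 2, 3, 1]} n k) =
      fps_nth (weight_enum (\<lambda>(p, q). inversions p + inversions q) (?A \<times> ?B)) k"
    by (simp add: av_def)
  also have "\<dots> = fps_nth (weight_enum inversions ?A * weight_enum inversions ?B) k"
    by (subst weight_enum_Times) auto
  also have "\<dots> = (\<Sum>i=0..k. fps_nth (weight_enum inversions ?A) i * fps_nth (weight_enum inversions ?B) (k - i))"
    by (rule fps_mult_nth)
  \<comment> \<open>Both indices are at most \<open>k < m \<le> l\<close>, so both factors are in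
    the range where the coefficients have stabilised.\<close>
  also have "\<dots> = (\<Sum>i=0..k. fps_nth (weight_enum sum_list good_parts) i *
      fps_nth (weight_enum sum_list good_parts) (k - i))"
    unfolding weight_enum_avoiders_rev_complement
    using ml by (intro sum.cong refl arg_cong2[of _ _ _ _ "(*)"] weight_enum_avoiders_132) (auto simp: m_def)
  also have "\<dots> = fps_nth (weight_enum sum_list good_parts ^ 2) k"
    unfolding power2_eq_square by (rule fps_mult_nth[symmetric])
  finally show ?thesis .
qed

theorem proposition5p9:
  shows "(\<exists>c. is_limit_sequence {[1,3,2,4], [4,2,3,1]} c) \<and>
    limit_gf {[1,3,2,4], [4,2,3,1]} =
      ((\<Prod>i. 1 + fps_X ^ (i + 1)) +
       (\<Sum>\<^sub>\<infinity>(a, b)\<in>UNIV. fps_X ^ ((a + 2) * (b + 1)) *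
          (\<Prod>i=1..a. 1 + fps_X ^ i) * (\<Prod>i=1..b. 1 + fps_X ^ i))) ^ 2"
proof -
  define G where "G = weight_enum sum_list good_parts ^ 2"
  \<comment> \<open>The coefficients of \<open>G\<close> are cardinalities by the next fact, so
    \<open>nat\<close> truncates nothing.\<close>
  define c where "c k = nat (fps_nth G k)" for k
  have av: "int (av {[1,3,2,4], [4,2,3,1]} n k) = fps_nth G k" if "4 * k + 3 \<le> n" for n k
    using av_eq_fps_nth[OF that] by (simp only: G_def)
  have lim: "is_limit_sequence {[1,3,2,4], [4,2,3,1]} c"
    unfolding is_limit_sequence_def c_def using av by (metis nat_int)
  have "int (c k) = fps_nth G k" for k
    using av[of k "4 * k + 3"] unfolding c_def by (metis le_refl nat_int)
  then have "limit_gf {[1,3,2,4], [4,2,3,1]} = G"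
    unfolding limit_gf_def limit_sequence_eqI[OF lim] by (simp add: fps_eq_iff)
  with lim show ?thesis
    unfolding G_def weight_enum_good_parts by blast
qed

end
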